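(* For every integer $n\ge 0$, every complete metric space $Y$ of generalized non-positive curvature satisfies $\mathrm{LC}(B^{n+1},\lambda_n)$ for $$\lambda_n=\sqrt{1+c_n^2},\qquad c_n=\frac{1}{\mathrm{Vol}(S^n)}\int_{S^n}|x-q|\,\mathrm{d}x,$$ where $q$ is an arbitrary point of $S^n$. In particular, such spaces are Lipschitz $n$-connected with constant $\sqrt3$ for every $n$.
   Context: $B^{m}\subset\mathbb{R}^{m}$ is the closed Euclidean unit ball, $S^{m-1}=\partial B^{m}$, both with the metric induced by the Euclidean norm $|\cdot|$; $\mathrm{d}x$ and $\mathrm{Vol}$ refer to the Riemannian volume measure on $S^n$ (counting measure if $n=0$); $c_n$ does not depend on $q$. A metric space $Y$ is a space of generalized non-positive curvature if it admits a symmetric map $m\colon Y\times Y\to Y$ such that $m(y,y)=y$ for all $y\in Y$ and $d(m(x,y),m(x,z))\le\tfrac12 d(y,z)$ for all $x,y,z\in Y$. For a convex body $K\subset\mathbb{R}^k$ (compact convex set with non-empty interior), $Y$ satisfies $\mathrm{LC}(K,\lambda)$ if for every $L$ every $L$-Lipschitz map $f\colon\partial K\to Y$ admits a $\lambda L$-Lipschitz extension $F\colon K\to Y$. $Y$ is Lipschitz $n$-connected with constant $\lambda$ if it satisfies $\mathrm{LC}(B^{m+1},\lambda)$ for every $0\le m\le n$. *)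

theory Defs
  imports "HOL-Analysis.Analysis" "Jordan_Normal_Form.Determinant"
begin

text \<open>
  The dimension varies inside the statement, so \<open>\<real>\<^sup>k\<close> is the carrier of
  \<^term>\<open>Euclidean_space k\<close>: the functions \<^typ>\<open>nat \<Rightarrow> real\<close> that vanish from index \<open>k\<close> on.
  The metric is given explicitly, because the \<^const>\<open>dist\<close> of \<^typ>\<open>nat \<Rightarrow> real\<close> is not the
  Euclidean one. The sphere \<open>S\<^sup>n\<close> is \<^term>\<open>topspace (nsphere n)\<close>.
\<close>

definition edist :: "nat \<Rightarrow> (nat \<Rightarrow> real) \<Rightarrow> (nat \<Rightarrow> real) \<Rightarrow> real" where
  "edist k x y = L2_set (\<lambda>i. x i - y i) {..<k}"

definition unit_eball :: "nat \<Rightarrow> (nat \<Rightarrow> real) set" where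
  "unit_eball k = {x \<in> topspace (Euclidean_space k). edist k x (\<lambda>_. 0) \<le> 1}"

text \<open>As in \<^const>\<open>lipschitz_on\<close>, the constant is required to be nonnegative.\<close>

definition elipschitz_on ::
  "nat \<Rightarrow> real \<Rightarrow> (nat \<Rightarrow> real) set \<Rightarrow> ((nat \<Rightarrow> real) \<Rightarrow> 'a::metric_space) \<Rightarrow> bool" where
  "elipschitz_on k L A f \<longleftrightarrow>
     0 \<le> L \<and> (\<forall>x\<in>A. \<forall>y\<in>A. dist (f x) (f y) \<le> L * edist k x y)"

text \<open>\<open>LC k K c Y\<close> is meant for convex bodies \<open>K \<subseteq> \<real>\<^sup>k\<close>.\<close>

definition LC :: "nat \<Rightarrow> (nat \<Rightarrow> real) set \<Rightarrow> real \<Rightarrow> 'a::metric_space set \<Rightarrow> bool" where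
  "LC k K c Y \<longleftrightarrow>
     (\<forall>L f. f \<in> (Euclidean_space k frontier_of K) \<rightarrow> Y
        \<and> elipschitz_on k L (Euclidean_space k frontier_of K) f \<longrightarrow>
        (\<exists>F. F \<in> K \<rightarrow> Y \<and> elipschitz_on k (c * L) K F
           \<and> (\<forall>x \<in> Euclidean_space k frontier_of K. F x = f x)))"

definition Lipschitz_connected :: "nat \<Rightarrow> real \<Rightarrow> 'a::metric_space set \<Rightarrow> bool" where
  "Lipschitz_connected n c Y \<longleftrightarrow> (\<forall>m\<le>n. LC (Suc m) (unit_eball (Suc m)) c Y)"

definition generalized_nonpos_curved :: "'a::metric_space set \<Rightarrow> bool" where
  "generalized_nonpos_curved Y \<longleftrightarrow>
     (\<exists>m. (\<forall>x\<in>Y. \<forall>y\<in>Y. m x y \<in> Y \<and> m x y = m y x)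
        \<and> (\<forall>y\<in>Y. m y y = y)
        \<and> (\<forall>x\<in>Y. \<forall>y\<in>Y. \<forall>z\<in>Y. dist (m x y) (m x z) \<le> 1/2 * dist y z))"

text \<open>
  The Riemannian volume of \<open>S\<^sup>n \<subseteq> \<real>\<^bsup>n+1\<^esup>\<close> is \<open>\<surd>det g du\<close> in local coordinates, where \<open>g\<close> is the
  pulled-back metric. The parametrizations of the two open hemispheres (\<open>s = \<plusminus>1\<close>) as graphs over
  the open unit ball of \<open>\<real>\<^sup>n\<close> cover \<open>S\<^sup>n\<close> up to the equator, a null set for \<open>n \<ge> 1\<close> and empty for
  \<open>n = 0\<close>. For \<open>n = 0\<close> the product measure is a unit point mass and the determinant is \<open>1\<close>, so one
  gets the counting measure on \<open>S\<^sup>0\<close>. Points \<open>u\<close> of the product space are only used at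
  indices below \<open>n\<close>.
\<close>

definition hemisphere_param :: "nat \<Rightarrow> real \<Rightarrow> (nat \<Rightarrow> real) \<Rightarrow> (nat \<Rightarrow> real)" where
  "hemisphere_param n s u =
     (\<lambda>i. if i < n then u i else if i = n then s * sqrt (1 - (\<Sum>j<n. (u j)\<^sup>2)) else 0)"

definition pullback_metric ::
  "nat \<Rightarrow> ((nat \<Rightarrow> real) \<Rightarrow> (nat \<Rightarrow> real)) \<Rightarrow> (nat \<Rightarrow> real) \<Rightarrow> real mat" where
  "pullback_metric n \<phi> u =
     mat n n (\<lambda>(i, j). \<Sum>k\<le>n. deriv (\<lambda>t. \<phi> (u(i := t)) k) (u i)
                              * deriv (\<lambda>t. \<phi> (u(j := t)) k) (u j))"

definition sphere_volume :: "nat \<Rightarrow> (nat \<Rightarrow> real) measure" where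
  "sphere_volume n =
     distr
       (density
          (count_space {-1, 1} \<Otimes>\<^sub>M
             restrict_space (\<Pi>\<^sub>M i\<in>{..<n}. lborel) {u. (\<Sum>j<n. (u j)\<^sup>2) < 1})
          (\<lambda>(s, u). ennreal (sqrt (Determinant.det (pullback_metric n (hemisphere_param n s) u)))))
       (restrict_space borel (topspace (nsphere n)))
       (\<lambda>(s, u). hemisphere_param n s u)"

definition mean_dist :: "nat \<Rightarrow> (nat \<Rightarrow> real) \<Rightarrow> real" where
  "mean_dist n q =
     (\<integral>x. edist (Suc n) x q \<partial>sphere_volume n)
       / measure (sphere_volume n) (topspace (nsphere n))"

end

theory Submission
  imports Defs "HOL-Probability.Weak_Convergence"
begin

text \<open>
  If some \<open>b \<in> Y\<close> satisfies \<open>d(b, f(q)) \<le> c L\<close> for all \<open>q\<close> in the sphere, then coning off \<open>f\<close> at \<open>b\<close>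
  along geodesics that contract towards \<open>b\<close> gives an extension with constant \<open>\<surd>(1 + c\<^sup>2) L\<close>, because
  \<open>|r p - s q|\<^sup>2 = (r - s)\<^sup>2 + r s |p - q|\<^sup>2\<close> for unit vectors \<open>p\<close> and \<open>q\<close>.

  Both the point \<open>b\<close> and the geodesics are means. A tournament of midpoints over the values of a map
  at the \<open>2\<^sup>k\<close> dyadic midpoints of the unit interval contracts the \<open>L\<^sup>1\<close> distance of maps, so the
  tournaments of a Riemann integrable map converge, and the limit is a mean with the same contraction
  property. The mean of the map with value \<open>y\<close> on \<open>(0, t)\<close> and \<open>x\<close> on \<open>(t, 1)\<close> is the point at time
  \<open>t\<close> of a geodesic from \<open>x\<close> to \<open>y\<close>. Quantile functions carry the mean over to every probability
  distribution on the line. The normalised volume of \<open>S\<^sup>n\<^sup>+\<^sup>1\<close> is an integral over the latitude of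
  normalised volumes of parallel copies of \<open>S\<^sup>n\<close>, so the mean of a Lipschitz map on \<open>S\<^sup>n\<^sup>+\<^sup>1\<close> can be
  taken first along the parallels and then over the latitude. It serves as \<open>b\<close> with \<open>c = c\<^sub>n\<close>.

  Slicing also shows by induction on the dimension that the integral of \<open>g(\<langle>x, q\<rangle>)\<close> over the sphere does
  not depend on \<open>q\<close>, and hence neither does \<open>c\<^sub>n\<close>. Finally \<open>c\<^sub>n \<le> \<surd>2\<close> because
  \<open>|x - q| + |x + q| \<le> 2 \<surd>2\<close> on the sphere.
\<close>

section \<open>Contracting means\<close>

text \<open>The bound is by measurable majorants \<open>\<psi>\<close> because \<open>\<lambda>x. dist (h x) (h' x)\<close> need not be measurable
  for measurable maps into a non-separable space.\<close>

definition contracting_mean ::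
  "'b measure \<Rightarrow> 'a::metric_space set \<Rightarrow> ('b \<Rightarrow> 'a) set \<Rightarrow> (('b \<Rightarrow> 'a) \<Rightarrow> 'a) \<Rightarrow> bool" where
  "contracting_mean M Y H \<beta> \<longleftrightarrow>
     (\<forall>h\<in>H. \<beta> h \<in> Y) \<and>
     (\<forall>y\<in>Y. \<beta> (\<lambda>_. y) = y) \<and>
     (\<forall>h\<in>H. \<forall>h'\<in>H. \<forall>\<psi>\<in>borel_measurable M.
        (\<forall>x\<in>space M. ennreal (dist (h x) (h' x)) \<le> \<psi> x) \<longrightarrow>
        ennreal (dist (\<beta> h) (\<beta> h')) \<le> (\<integral>\<^sup>+x. \<psi> x \<partial>M))"

lemma contracting_mean_in: "\<lbrakk>contracting_mean M Y H \<beta>; h \<in> H\<rbrakk> \<Longrightarrow> \<beta> h \<in> Y"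
  by (simp add: contracting_mean_def)

lemma contracting_mean_const: "\<lbrakk>contracting_mean M Y H \<beta>; y \<in> Y\<rbrakk> \<Longrightarrow> \<beta> (\<lambda>_. y) = y"
  by (simp add: contracting_mean_def)

lemma contracting_mean_dist_le:
  assumes "contracting_mean M Y H \<beta>" "h \<in> H" "h' \<in> H" "\<psi> \<in> borel_measurable M"
    and "\<And>x. x \<in> space M \<Longrightarrow> ennreal (dist (h x) (h' x)) \<le> \<psi> x"
  shows "ennreal (dist (\<beta> h) (\<beta> h')) \<le> (\<integral>\<^sup>+x. \<psi> x \<partial>M)"
  using assms by (simp add: contracting_mean_def)

lemma contracting_mean_uniform_dist_le:
  assumes "contracting_mean M Y H \<beta>" "prob_space M" "h \<in> H" "h' \<in> H" "0 \<le> e"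
    and "\<And>x. x \<in> space M \<Longrightarrow> dist (h x) (h' x) \<le> e"
  shows "dist (\<beta> h) (\<beta> h') \<le> e"
proof -
  interpret prob_space M by fact
  have "ennreal (dist (\<beta> h) (\<beta> h')) \<le> (\<integral>\<^sup>+x. ennreal e \<partial>M)"
    using assms by (intro contracting_mean_dist_le[OF assms(1)]) (auto intro: ennreal_leI)
  then show ?thesis using assms(5) by (simp add: emeasure_space_1 ennreal_le_iff)
qed

section \<open>Midpoint tournaments over the unit interval\<close>

abbreviation unit_interval :: "real measure" where
  "unit_interval \<equiv> restrict_space lborel {0<..<1}"

lemma prob_space_unit_interval: "prob_space unit_interval"
  by (rule prob_spaceI) (simp add: space_restrict_space emeasure_restrict_space)

lemma emeasure_unit_interval [simp]: "emeasure unit_interval {0<..<1} = 1"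
  by (simp add: emeasure_restrict_space)

lemma nn_integral_unit_interval_halve:
  assumes [measurable]: "f \<in> borel_measurable borel"
  shows "(\<integral>\<^sup>+u. f u \<partial>unit_interval) =
    ennreal (1/2) * ((\<integral>\<^sup>+u. f (u / 2) \<partial>unit_interval) + (\<integral>\<^sup>+u. f ((u + 1) / 2) \<partial>unit_interval))"
proof -
  have "(\<integral>\<^sup>+u\<in>{0<..<1}. f u \<partial>lborel)
    = (\<integral>\<^sup>+u. f u * indicator {0<..<1/2} u + f u * indicator {1/2<..<1} u \<partial>lborel)"
    by (rule nn_integral_cong_AE, rule AE_mp[OF AE_lborel_singleton[of "1/2"]])
       (auto split: split_indicator)
  also have "\<dots> = (\<integral>\<^sup>+u\<in>{0<..<1/2}. f u \<partial>lborel) + (\<integral>\<^sup>+u\<in>{1/2<..<1}. f u \<partial>lborel)"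
    by (rule nn_integral_add) auto
  also have "(\<integral>\<^sup>+u\<in>{0<..<1/2}. f u \<partial>lborel) = ennreal (1/2) * (\<integral>\<^sup>+u\<in>{0<..<1}. f (u / 2) \<partial>lborel)"
    by (subst nn_integral_real_affine[of _ "1/2" 0])
       (auto intro!: arg_cong2[where f="(*)"] nn_integral_cong split: split_indicator)
  also have "(\<integral>\<^sup>+u\<in>{1/2<..<1}. f u \<partial>lborel) = ennreal (1/2) * (\<integral>\<^sup>+u\<in>{0<..<1}. f ((u + 1) / 2) \<partial>lborel)"
    by (subst nn_integral_real_affine[of _ "1/2" "1/2"])
       (auto intro!: arg_cong2[where f="(*)"] nn_integral_cong
         simp: add_divide_distrib add.commute split: split_indicator)
  finally show ?thesis by (simp add: nn_integral_restrict_space distrib_left)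
qed

definition dyadic_midpoint :: "nat \<Rightarrow> real \<Rightarrow> real" where
  "dyadic_midpoint k u = (of_int \<lfloor>2 ^ k * u\<rfloor> + 1/2) / 2 ^ k"

lemma dyadic_midpoint_0: "u \<in> {0<..<1} \<Longrightarrow> dyadic_midpoint 0 u = 1/2"
  by (simp add: dyadic_midpoint_def floor_eq_iff[of u 0, THEN iffD2])

lemma dyadic_midpoint_Suc_left: "dyadic_midpoint (Suc k) (u / 2) = dyadic_midpoint k u / 2"
  by (simp add: dyadic_midpoint_def)

lemma dyadic_midpoint_Suc_right: "dyadic_midpoint (Suc k) ((u + 1) / 2) = (dyadic_midpoint k u + 1) / 2"
proof -
  have "2 ^ Suc k * ((u + 1) / 2) = 2 ^ k * u + of_int (2 ^ k)" by (simp add: distrib_left)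
  then have "\<lfloor>2 ^ Suc k * ((u + 1) / 2)\<rfloor> = \<lfloor>2 ^ k * u\<rfloor> + 2 ^ k" by (simp only: floor_add_int)
  then show ?thesis by (simp add: dyadic_midpoint_def field_simps)
qed

lemma dyadic_midpoint_error: "\<bar>dyadic_midpoint k u - u\<bar> \<le> (1/2) ^ k"
proof -
  have "dyadic_midpoint k u - u = (of_int \<lfloor>2 ^ k * u\<rfloor> + 1/2 - 2 ^ k * u) * (1/2) ^ k"
    by (simp add: dyadic_midpoint_def field_simps)
  moreover have "\<bar>of_int \<lfloor>2 ^ k * u\<rfloor> + 1/2 - 2 ^ k * u\<bar> \<le> 1" by linarith
  ultimately show ?thesis using mult_right_mono[of _ 1 "(1/2::real) ^ k"] by (simp add: abs_mult)
qed

lemma dyadic_midpoint_tendsto: "(\<lambda>k. dyadic_midpoint k u) \<longlonglongrightarrow> u"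
proof (rule LIM_zero_cancel, rule Lim_null_comparison)
  show "\<forall>\<^sub>F k in sequentially. norm (dyadic_midpoint k u - u) \<le> (1/2) ^ k"
    by (simp add: dyadic_midpoint_error)
qed (auto intro: LIMSEQ_power_zero)

lemma measurable_compose_dyadic_midpoint:
  assumes "\<And>c. (\<lambda>u. f c u) \<in> borel \<rightarrow>\<^sub>M N"
  shows "(\<lambda>u. f (dyadic_midpoint k u) u) \<in> borel \<rightarrow>\<^sub>M N"
  unfolding dyadic_midpoint_def
proof (rule measurable_compose_countable[where f="\<lambda>i u. f ((of_int i + 1/2) / 2 ^ k) u"])
  show "(\<lambda>u. f ((of_int i + 1/2) / 2 ^ k) u) \<in> borel \<rightarrow>\<^sub>M N" for i :: int
    by (rule assms)
qed measurable

lemma measurable_dist_dyadic_midpoint: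
  "(\<lambda>u. ennreal (dist (h (dyadic_midpoint k u)) (h' (dyadic_midpoint l u)))) \<in> borel_measurable borel"
proof (rule measurable_compose_dyadic_midpoint
    [where f="\<lambda>c u. ennreal (dist (h c) (h' (dyadic_midpoint l u)))"])
  show "(\<lambda>u. ennreal (dist (h c) (h' (dyadic_midpoint l u)))) \<in> borel_measurable borel" for c
    by (rule measurable_compose_dyadic_midpoint[where f="\<lambda>c' _. ennreal (dist (h c) (h' c'))"]) simp
qed

locale midpoint_space =
  fixes Y :: "'a::metric_space set" and mid :: "'a \<Rightarrow> 'a \<Rightarrow> 'a"
  assumes mid_in: "\<lbrakk>x \<in> Y; y \<in> Y\<rbrakk> \<Longrightarrow> mid x y \<in> Y"
    and mid_commute: "\<lbrakk>x \<in> Y; y \<in> Y\<rbrakk> \<Longrightarrow> mid x y = mid y x"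
    and mid_idem: "y \<in> Y \<Longrightarrow> mid y y = y"
    and mid_contract: "\<lbrakk>x \<in> Y; y \<in> Y; z \<in> Y\<rbrakk> \<Longrightarrow> dist (mid x y) (mid x z) \<le> 1/2 * dist y z"
begin

lemma dist_mid_le:
  assumes "x \<in> Y" "y \<in> Y" "x' \<in> Y" "y' \<in> Y"
  shows "dist (mid x y) (mid x' y') \<le> (dist x x' + dist y y') / 2"
proof -
  have "dist (mid x y) (mid x' y') \<le> dist (mid x y) (mid x y') + dist (mid x y') (mid x' y')"
    by (rule dist_triangle)
  also have "dist (mid x y) (mid x y') \<le> 1/2 * dist y y'"
    using assms by (intro mid_contract)
  also have "dist (mid x y') (mid x' y') \<le> 1/2 * dist x x'"
    using assms mid_contract[of y' x x'] by (simp add: mid_commute)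
  finally show ?thesis by (simp add: field_simps)
qed

lemma ennreal_dist_mid_le:
  assumes "x \<in> Y" "y \<in> Y" "x' \<in> Y" "y' \<in> Y"
  shows "ennreal (dist (mid x y) (mid x' y'))
      \<le> ennreal (1/2) * (ennreal (dist x x') + ennreal (dist y y'))"
proof -
  have "ennreal (dist (mid x y) (mid x' y')) \<le> ennreal (1/2 * (dist x x' + dist y y'))"
    using dist_mid_le[OF assms] by (intro ennreal_leI) simp
  also have "\<dots> = ennreal (1/2) * (ennreal (dist x x') + ennreal (dist y y'))"
    by (subst ennreal_mult) (auto simp: ennreal_plus)
  finally show ?thesis .
qed

primrec tournament :: "nat \<Rightarrow> (real \<Rightarrow> 'a) \<Rightarrow> 'a" where
  "tournament 0 h = h (1/2)"
| "tournament (Suc k) h = mid (tournament k (\<lambda>u. h (u / 2))) (tournament k (\<lambda>u. h ((u + 1) / 2)))"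

lemma tournament_in: "(\<And>u. h u \<in> Y) \<Longrightarrow> tournament k h \<in> Y"
  by (induction k arbitrary: h) (auto intro: mid_in)

lemma tournament_const: "y \<in> Y \<Longrightarrow> tournament k (\<lambda>_. y) = y"
  by (induction k) (auto simp: mid_idem)

lemma dist_tournament_Suc_le:
  assumes Y: "\<And>u. h u \<in> Y" "\<And>u. h' u \<in> Y"
    and left: "ennreal (dist (tournament k (\<lambda>u. h (u / 2))) (tournament l (\<lambda>u. h' (u / 2))))
      \<le> (\<integral>\<^sup>+u. ennreal (dist (h (dyadic_midpoint k u / 2)) (h' (dyadic_midpoint l u / 2)))
        \<partial>unit_interval)"
    and right: "ennreal (dist (tournament k (\<lambda>u. h ((u + 1) / 2))) (tournament l (\<lambda>u. h' ((u + 1) / 2))))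
      \<le> (\<integral>\<^sup>+u. ennreal (dist (h ((dyadic_midpoint k u + 1) / 2)) (h' ((dyadic_midpoint l u + 1) / 2)))
        \<partial>unit_interval)"
  shows "ennreal (dist (tournament (Suc k) h) (tournament (Suc l) h')) \<le>
    (\<integral>\<^sup>+u. ennreal (dist (h (dyadic_midpoint (Suc k) u)) (h' (dyadic_midpoint (Suc l) u)))
      \<partial>unit_interval)"
proof -
  define f where
    "f u = ennreal (dist (h (dyadic_midpoint (Suc k) u)) (h' (dyadic_midpoint (Suc l) u)))" for u
  have f: "f \<in> borel_measurable borel" unfolding f_def by (rule measurable_dist_dyadic_midpoint)
  have "ennreal (dist (tournament (Suc k) h) (tournament (Suc l) h')) \<le> ennreal (1/2) *
      (ennreal (dist (tournament k (\<lambda>u. h (u / 2))) (tournament l (\<lambda>u. h' (u / 2)))) +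
       ennreal (dist (tournament k (\<lambda>u. h ((u + 1) / 2))) (tournament l (\<lambda>u. h' ((u + 1) / 2)))))"
    unfolding tournament.simps using Y by (intro ennreal_dist_mid_le tournament_in)
  also have "\<dots>
      \<le> ennreal (1/2) * ((\<integral>\<^sup>+u. f (u / 2) \<partial>unit_interval) + (\<integral>\<^sup>+u. f ((u + 1) / 2) \<partial>unit_interval))"
    unfolding f_def dyadic_midpoint_Suc_right unfolding dyadic_midpoint_Suc_left
    using left right by (intro mult_left_mono add_mono) auto
  also have "\<dots> = (\<integral>\<^sup>+u. f u \<partial>unit_interval)"
    by (rule nn_integral_unit_interval_halve[OF f, symmetric])
  finally show ?thesis unfolding f_def .
qed

text \<open>For \<open>k = l\<close> this bounds the change of a tournament under a change of the map, for \<open>h = h'\<close> its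
  change under refinement.\<close>

lemma dist_tournament_le:
  assumes "k \<le> l" "\<And>u. h u \<in> Y" "\<And>u. h' u \<in> Y"
  shows "ennreal (dist (tournament k h) (tournament l h')) \<le>
    (\<integral>\<^sup>+u. ennreal (dist (h (dyadic_midpoint k u)) (h' (dyadic_midpoint l u))) \<partial>unit_interval)"
  using assms
proof (induction l arbitrary: k h h')
  case 0
  have "(\<integral>\<^sup>+u. ennreal (dist (h (dyadic_midpoint 0 u)) (h' (dyadic_midpoint 0 u))) \<partial>unit_interval)
    = (\<integral>\<^sup>+u. ennreal (dist (h (1/2)) (h' (1/2))) \<partial>unit_interval)"
    by (rule nn_integral_cong) (simp add: space_restrict_space dyadic_midpoint_0)
  then show ?case using \<open>k \<le> 0\<close> by (simp add: space_restrict_space)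
next
  case (Suc l)
  have step: "ennreal (dist (tournament (Suc j) g) (tournament (Suc l) h')) \<le>
    (\<integral>\<^sup>+u. ennreal (dist (g (dyadic_midpoint (Suc j) u)) (h' (dyadic_midpoint (Suc l) u)))
      \<partial>unit_interval)"
    if "j \<le> l" "\<And>u. g u \<in> Y" for j g
    by (rule dist_tournament_Suc_le) (rule that Suc.prems(3) Suc.IH[OF that Suc.prems(3)])+
  show ?case
  proof (cases k)
    case 0
    have "ennreal (dist (h (1/2)) (tournament (Suc l) h')) \<le>
      (\<integral>\<^sup>+u. ennreal (dist (h (1/2)) (h' (dyadic_midpoint (Suc l) u))) \<partial>unit_interval)"
      using step[of 0 "\<lambda>_. h (1/2)"] Suc.prems(2) by (simp add: mid_idem)
    also have "\<dots>
        = (\<integral>\<^sup>+u. ennreal (dist (h (dyadic_midpoint 0 u)) (h' (dyadic_midpoint (Suc l) u)))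
          \<partial>unit_interval)"
      by (rule nn_integral_cong) (simp add: space_restrict_space dyadic_midpoint_0)
    finally show ?thesis using 0 by simp
  next
    case (Suc j)
    then show ?thesis using step[of j h] Suc.prems(1,2) by simp
  qed
qed

end

text \<open>By Lebesgue's criterion these are the Riemann integrable maps; they need not be measurable.\<close>

definition riemann_maps :: "'a::metric_space set \<Rightarrow> (real \<Rightarrow> 'a) set" where
  "riemann_maps Y = {h. range h \<subseteq> Y \<and> bounded (range h) \<and> (AE u in unit_interval. isCont h u)}"

definition dyadic_osc :: "(real \<Rightarrow> 'a::metric_space) \<Rightarrow> nat \<Rightarrow> real \<Rightarrow> ennreal" where
  "dyadic_osc h k u = (SUP j. ennreal (dist (h (dyadic_midpoint k u)) (h (dyadic_midpoint (k + j) u))))"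

lemma measurable_dyadic_osc: "dyadic_osc h k \<in> borel_measurable unit_interval"
proof -
  have "dyadic_osc h k \<in> borel_measurable borel"
    unfolding dyadic_osc_def[abs_def]
    by (intro borel_measurable_SUP measurable_dist_dyadic_midpoint) simp
  then show ?thesis by (intro measurable_restrict_space1) simp
qed

lemma dist_dyadic_midpoint_tendsto:
  assumes "isCont h u"
  shows "(\<lambda>k. dist (h (dyadic_midpoint k u)) (h u)) \<longlonglongrightarrow> 0"
  by (rule tendsto_dist_iff[THEN iffD1] isCont_tendsto_compose[OF assms] dyadic_midpoint_tendsto)+

lemma dist_le_dyadic_osc:
  assumes "isCont h u"
  shows "ennreal (dist (h (dyadic_midpoint k u)) (h u)) \<le> dyadic_osc h k u"
proof (rule LIMSEQ_le_const2)
  have "(\<lambda>j. h (dyadic_midpoint (j + k) u)) \<longlonglongrightarrow> h u"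
    by (rule LIMSEQ_ignore_initial_segment isCont_tendsto_compose[OF assms] dyadic_midpoint_tendsto)+
  then show "(\<lambda>j. ennreal (dist (h (dyadic_midpoint k u)) (h (dyadic_midpoint (k + j) u))))
      \<longlonglongrightarrow> ennreal (dist (h (dyadic_midpoint k u)) (h u))"
    by (intro tendsto_intros) (simp add: add.commute)
qed (auto simp: dyadic_osc_def intro!: exI SUP_upper)

lemma dist_dyadic_midpoint_le:
  assumes "isCont h u" "isCont h' u"
  shows "ennreal (dist (h (dyadic_midpoint k u)) (h' (dyadic_midpoint k u)))
    \<le> dyadic_osc h k u + ennreal (dist (h u) (h' u)) + dyadic_osc h' k u"
proof -
  let ?g = "dyadic_midpoint k u"
  have "dist (h ?g) (h' ?g) \<le> dist (h ?g) (h u) + dist (h u) (h' u) + dist (h' ?g) (h' u)"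
    using dist_triangle[of "h ?g" "h' ?g" "h u"] dist_triangle2[of "h u" "h' ?g" "h' u"] by simp
  then have "ennreal (dist (h ?g) (h' ?g))
    \<le> ennreal (dist (h ?g) (h u)) + ennreal (dist (h u) (h' u)) + ennreal (dist (h' ?g) (h' u))"
    by (simp add: ennreal_leI flip: ennreal_plus)
  also have "\<dots> \<le> dyadic_osc h k u + ennreal (dist (h u) (h' u)) + dyadic_osc h' k u"
    using assms by (intro add_mono dist_le_dyadic_osc order_refl)
  finally show ?thesis .
qed

lemma dyadic_osc_tendsto:
  assumes "isCont h u"
  shows "(\<lambda>k. dyadic_osc h k u) \<longlonglongrightarrow> 0"
proof (rule tendsto_zero_ennreal)
  fix e :: real assume e: "0 < e"
  let ?d = "\<lambda>k. dist (h (dyadic_midpoint k u)) (h u)"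
  have "\<forall>\<^sub>F k in sequentially. ?d k < e / 4"
    using dist_dyadic_midpoint_tendsto[OF assms] e by (intro order_tendstoD) auto
  then obtain K where K: "\<And>k. k \<ge> K \<Longrightarrow> ?d k < e / 4" unfolding eventually_sequentially by blast
  show "\<forall>\<^sub>F k in sequentially. dyadic_osc h k u < ennreal e"
  proof (rule eventually_sequentiallyI)
    fix k assume "K \<le> k"
    have "dyadic_osc h k u \<le> ennreal (e / 2)"
      unfolding dyadic_osc_def
    proof (intro SUP_least ennreal_leI)
      fix j
      show "dist (h (dyadic_midpoint k u)) (h (dyadic_midpoint (k + j) u)) \<le> e / 2"
        using K[of k] K[of "k + j"] \<open>K \<le> k\<close>
          dist_triangle2[of "h (dyadic_midpoint k u)" "h (dyadic_midpoint (k + j) u)" "h u"]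
        by simp
    qed
    also have "\<dots> < ennreal e" using e by (simp add: ennreal_lessI)
    finally show "dyadic_osc h k u < ennreal e" .
  qed
qed

lemma nn_integral_dyadic_osc_tendsto:
  assumes h: "h \<in> riemann_maps Y"
  shows "(\<lambda>k. \<integral>\<^sup>+u. dyadic_osc h k u \<partial>unit_interval) \<longlonglongrightarrow> 0"
proof -
  have "bounded (range h)" using h by (simp add: riemann_maps_def)
  then obtain C where C: "\<And>u v. dist (h u) (h v) \<le> C"
    unfolding bounded_two_points by auto
  have "(\<lambda>k. \<integral>\<^sup>+u. dyadic_osc h k u \<partial>unit_interval) \<longlonglongrightarrow> (\<integral>\<^sup>+u. 0 \<partial>unit_interval)"
  proof (rule nn_integral_dominated_convergence[where w="\<lambda>_. ennreal C"])
    show "(\<lambda>u. dyadic_osc h k u) \<in> borel_measurable unit_interval" for k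
      by (rule measurable_dyadic_osc)
    show "AE u in unit_interval. dyadic_osc h k u \<le> ennreal C" for k
      by (auto simp: dyadic_osc_def intro!: SUP_least ennreal_leI C)
    show "AE u in unit_interval. (\<lambda>k. dyadic_osc h k u) \<longlonglongrightarrow> 0"
      using h by (auto simp: riemann_maps_def elim!: eventually_mono intro: dyadic_osc_tendsto)
  qed (auto simp: space_restrict_space ennreal_mult_less_top)
  then show ?thesis by simp
qed

context midpoint_space
begin

lemma dist_tournament_refine_le:
  assumes "h \<in> riemann_maps Y"
  shows "ennreal (dist (tournament k h) (tournament (k + j) h)) \<le> (\<integral>\<^sup>+u. dyadic_osc h k u \<partial>unit_interval)"
proof -
  have "h u \<in> Y" for u using assms by (auto simp: riemann_maps_def)
  then have "ennreal (dist (tournament k h) (tournament (k + j) h)) \<le>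
    (\<integral>\<^sup>+u. ennreal (dist (h (dyadic_midpoint k u)) (h (dyadic_midpoint (k + j) u))) \<partial>unit_interval)"
    by (intro dist_tournament_le) simp_all
  also have "\<dots> \<le> (\<integral>\<^sup>+u. dyadic_osc h k u \<partial>unit_interval)"
    by (intro nn_integral_mono) (auto simp: dyadic_osc_def intro: SUP_upper)
  finally show ?thesis .
qed

lemma dist_tournaments_le_add_dyadic_osc:
  assumes h: "h \<in> riemann_maps Y" and h': "h' \<in> riemann_maps Y"
    and \<psi>[measurable]: "\<psi> \<in> borel_measurable unit_interval"
    and le: "\<And>u. u \<in> {0<..<1} \<Longrightarrow> ennreal (dist (h u) (h' u)) \<le> \<psi> u"
  shows "ennreal (dist (tournament k h) (tournament k h')) \<le> (\<integral>\<^sup>+u. dyadic_osc h k u \<partial>unit_interval)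
    + (\<integral>\<^sup>+u. \<psi> u \<partial>unit_interval) + (\<integral>\<^sup>+u. dyadic_osc h' k u \<partial>unit_interval)"
proof -
  have "\<And>u. h u \<in> Y" "\<And>u. h' u \<in> Y" using h h' by (auto simp: riemann_maps_def)
  then have "ennreal (dist (tournament k h) (tournament k h')) \<le>
    (\<integral>\<^sup>+u. ennreal (dist (h (dyadic_midpoint k u)) (h' (dyadic_midpoint k u))) \<partial>unit_interval)"
    by (intro dist_tournament_le) simp_all
  also have "\<dots> \<le> (\<integral>\<^sup>+u. dyadic_osc h k u + \<psi> u + dyadic_osc h' k u \<partial>unit_interval)"
  proof (rule nn_integral_mono_AE)
    have "AE u in unit_interval. isCont h u" "AE u in unit_interval. isCont h' u"
      using h h' by (auto simp: riemann_maps_def)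
    then show "AE u in unit_interval. ennreal (dist (h (dyadic_midpoint k u)) (h' (dyadic_midpoint k u)))
      \<le> dyadic_osc h k u + \<psi> u + dyadic_osc h' k u"
      using AE_space
    proof eventually_elim
      case (elim u)
      then have "ennreal (dist (h u) (h' u)) \<le> \<psi> u" by (intro le) (simp add: space_restrict_space)
      then show ?case
        by (intro order_trans[OF dist_dyadic_midpoint_le[OF elim(1,2)]] add_mono) simp_all
    qed
  qed
  also have "\<dots> = (\<integral>\<^sup>+u. dyadic_osc h k u \<partial>unit_interval)
    + (\<integral>\<^sup>+u. \<psi> u \<partial>unit_interval) + (\<integral>\<^sup>+u. dyadic_osc h' k u \<partial>unit_interval)"
    using measurable_dyadic_osc[measurable] by (simp add: nn_integral_add)
  finally show ?thesis .
qed

definition interval_mean :: "(real \<Rightarrow> 'a) \<Rightarrow> 'a" where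
  "interval_mean h = lim (\<lambda>k. tournament k h)"

end

locale complete_midpoint_space = midpoint_space +
  assumes complete: "complete Y"
begin

lemma tournament_tendsto:
  assumes h: "h \<in> riemann_maps Y"
  shows "interval_mean h \<in> Y" "(\<lambda>k. tournament k h) \<longlonglongrightarrow> interval_mean h"
proof -
  have "Cauchy (\<lambda>k. tournament k h)"
  proof (rule CauchyI')
    fix e :: real assume e: "0 < e"
    have "\<forall>\<^sub>F k in sequentially. (\<integral>\<^sup>+u. dyadic_osc h k u \<partial>unit_interval) < ennreal e"
      using order_tendstoD(2)[OF nn_integral_dyadic_osc_tendsto[OF h], of "ennreal e"] e by simp
    then obtain K where K: "\<And>k. k \<ge> K \<Longrightarrow> (\<integral>\<^sup>+u. dyadic_osc h k u \<partial>unit_interval) < ennreal e"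
      unfolding eventually_sequentially by blast
    show "\<exists>K. \<forall>m\<ge>K. \<forall>n>m. dist (tournament m h) (tournament n h) < e"
    proof (intro exI allI impI)
      fix m n assume "K \<le> m" "m < n"
      then have "ennreal (dist (tournament m h) (tournament n h)) < ennreal e"
        using order_le_less_trans[OF dist_tournament_refine_le[OF h, of m "n - m"] K] by simp
      then show "dist (tournament m h) (tournament n h) < e" by (simp add: ennreal_less_iff)
    qed
  qed
  moreover have "tournament k h \<in> Y" for k
    using h by (intro tournament_in) (auto simp: riemann_maps_def)
  ultimately obtain l where "l \<in> Y" "(\<lambda>k. tournament k h) \<longlonglongrightarrow> l"
    using completeE[OF complete, of "\<lambda>k. tournament k h"] by blast
  then show "interval_mean h \<in> Y" "(\<lambda>k. tournament k h) \<longlonglongrightarrow> interval_mean h"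
    by (simp_all add: interval_mean_def limI)
qed

lemma contracting_mean_interval_mean: "contracting_mean unit_interval Y (riemann_maps Y) interval_mean"
  unfolding contracting_mean_def
proof (intro conjI ballI impI)
  show "interval_mean h \<in> Y" if "h \<in> riemann_maps Y" for h
    using that by (rule tournament_tendsto)
  show "interval_mean (\<lambda>_. y) = y" if "y \<in> Y" for y
    using that by (simp add: interval_mean_def tournament_const)
next
  fix h h' \<psi>
  assume h: "h \<in> riemann_maps Y" "h' \<in> riemann_maps Y" and \<psi>: "\<psi> \<in> borel_measurable unit_interval"
    "\<forall>u\<in>space unit_interval. ennreal (dist (h u) (h' u)) \<le> \<psi> u"
  have "ennreal (dist (interval_mean h) (interval_mean h')) \<le> 0 + (\<integral>\<^sup>+u. \<psi> u \<partial>unit_interval) + 0"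
  proof (rule LIMSEQ_le)
    show "(\<lambda>k. ennreal (dist (tournament k h) (tournament k h')))
        \<longlonglongrightarrow> ennreal (dist (interval_mean h) (interval_mean h'))"
      by (intro tendsto_intros tournament_tendsto h)
    show "(\<lambda>k. (\<integral>\<^sup>+u. dyadic_osc h k u \<partial>unit_interval) + (\<integral>\<^sup>+u. \<psi> u \<partial>unit_interval)
        + (\<integral>\<^sup>+u. dyadic_osc h' k u \<partial>unit_interval)) \<longlonglongrightarrow> 0 + (\<integral>\<^sup>+u. \<psi> u \<partial>unit_interval) + 0"
      by (intro tendsto_intros nn_integral_dyadic_osc_tendsto[OF h(1)]
        nn_integral_dyadic_osc_tendsto[OF h(2)])
  qed (use dist_tournaments_le_add_dyadic_osc[OF h \<psi>(1)] \<psi>(2) in \<open>auto simp: space_restrict_space\<close>)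
  then show "ennreal (dist (interval_mean h) (interval_mean h')) \<le> (\<integral>\<^sup>+u. \<psi> u \<partial>unit_interval)" by simp
qed

end

lemma (in cdf_distribution) AE_isCont_quantile: "AE u in unit_interval. isCont I u"
proof -
  have "countable {u \<in> {0<..<1}. \<not> isCont I u}"
    using mono_on_ctble_discont[OF mono_I] by (simp add: at_within_open[of _ "{0<..<1}"] cong: conj_cong)
  then have "AE u in lborel. u \<notin> {u \<in> {0<..<1}. \<not> isCont I u}"
    by (intro AE_not_in countable_imp_null_set_lborel)
  then show ?thesis
    by (subst AE_restrict_space_iff) (auto elim: eventually_mono)
qed

lemma (in cdf_distribution) nn_integral_quantile:
  assumes f: "f \<in> borel_measurable borel"
  shows "(\<lambda>u. f (I u)) \<in> borel_measurable unit_interval" "(\<integral>\<^sup>+u. f (I u) \<partial>unit_interval) = (\<integral>\<^sup>+x. f x \<partial>M)"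
proof -
  have I: "I \<in> unit_interval \<rightarrow>\<^sub>M borel"
    using measurable_CI by (simp cong: measurable_cong_sets sets_restrict_space_cong)
  show "(\<lambda>u. f (I u)) \<in> borel_measurable unit_interval" by (rule measurable_compose[OF I f])
  have "(\<integral>\<^sup>+u. f (I u) \<partial>unit_interval) = (\<integral>\<^sup>+x. f x \<partial>distr unit_interval borel I)"
    using I f by (intro nn_integral_distr[symmetric]) auto
  then show "(\<integral>\<^sup>+u. f (I u) \<partial>unit_interval) = (\<integral>\<^sup>+x. f x \<partial>M)" by (simp only: distr_I_eq_M)
qed

definition bounded_continuous_maps :: "'a::metric_space set \<Rightarrow> (real \<Rightarrow> 'a) set" where
  "bounded_continuous_maps Y = {h. range h \<subseteq> Y \<and> bounded (range h) \<and> continuous_on UNIV h}"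

lemma (in cdf_distribution) compose_quantile_in_riemann_maps:
  assumes h: "h \<in> bounded_continuous_maps Y"
  shows "(\<lambda>u. h (I u)) \<in> riemann_maps Y"
proof -
  have "isCont h x" for x
    using h by (simp add: bounded_continuous_maps_def continuous_on_eq_continuous_at)
  then have "isCont (\<lambda>u. h (I u)) u" if "isCont I u" for u
    using that by (rule isCont_o2[rotated])
  with AE_isCont_quantile have "AE u in unit_interval. isCont (\<lambda>u. h (I u)) u"
    by (rule eventually_mono)
  moreover have "bounded (range (\<lambda>u. h (I u)))"
    using h by (auto simp: bounded_continuous_maps_def intro: bounded_subset)
  ultimately show ?thesis using h by (auto simp: riemann_maps_def bounded_continuous_maps_def)
qed

lemma (in complete_midpoint_space) ex_contracting_mean_real_distribution:
  assumes "real_distribution M"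
  shows "\<exists>\<beta>. contracting_mean M Y (bounded_continuous_maps Y) \<beta>"
proof -
  interpret cdf_distribution M using assms by (simp add: cdf_distribution_def)
  note mean = contracting_mean_interval_mean and I = compose_quantile_in_riemann_maps
  have "contracting_mean M Y (bounded_continuous_maps Y) (\<lambda>h. interval_mean (\<lambda>u. h (I u)))"
    unfolding contracting_mean_def
  proof (intro conjI ballI impI)
    fix h h' \<psi>
    assume h: "h \<in> bounded_continuous_maps Y" "h' \<in> bounded_continuous_maps Y"
      and "\<psi> \<in> borel_measurable M" and bound: "\<forall>x\<in>space M. ennreal (dist (h x) (h' x)) \<le> \<psi> x"
    then have \<psi>: "\<psi> \<in> borel_measurable borel" by (simp cong: measurable_cong_sets)
    have "ennreal (dist (interval_mean (\<lambda>u. h (I u))) (interval_mean (\<lambda>u. h' (I u))))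
      \<le> (\<integral>\<^sup>+u. \<psi> (I u) \<partial>unit_interval)"
      using bound by (intro contracting_mean_dist_le[OF mean] I h nn_integral_quantile \<psi>) simp
    then show "ennreal (dist (interval_mean (\<lambda>u. h (I u))) (interval_mean (\<lambda>u. h' (I u))))
        \<le> (\<integral>\<^sup>+x. \<psi> x \<partial>M)"
      by (simp only: nn_integral_quantile[OF \<psi>])
  qed (auto intro: contracting_mean_in[OF mean I] contracting_mean_const[OF mean])
  then show ?thesis by blast
qed

section \<open>Conical geodesics\<close>

context complete_midpoint_space
begin

definition geodesic :: "real \<Rightarrow> 'a \<Rightarrow> 'a \<Rightarrow> 'a" where
  "geodesic t x y = interval_mean (\<lambda>u. if u < t then y else x)"

lemma step_in_riemann_maps:
  assumes "x \<in> Y" "y \<in> Y"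
  shows "(\<lambda>u. if u < t then y else x) \<in> riemann_maps Y"
proof -
  let ?h = "\<lambda>u. if u < t then y else x"
  have "isCont ?h u" if "u \<noteq> t" for u
  proof (cases "u < t")
    case True
    then have "\<forall>\<^sub>F v in nhds u. ?h v = y"
      by (intro eventually_mono[OF eventually_nhds_in_open[of "{..<t}" u]]) auto
    then show ?thesis using isCont_cong[of ?h "\<lambda>_. y"] by simp
  next
    case False
    then have "\<forall>\<^sub>F v in nhds u. ?h v = x"
      using that by (intro eventually_mono[OF eventually_nhds_in_open[of "{t<..}" u]]) auto
    then show ?thesis using isCont_cong[of ?h "\<lambda>_. x"] by simp
  qed
  then have "AE u in lborel. isCont ?h u"
    using AE_lborel_singleton[of t] by (auto elim: eventually_mono)
  then have "AE u in unit_interval. isCont ?h u"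
    by (subst AE_restrict_space_iff) (auto elim: eventually_mono)
  moreover have "bounded (range ?h)" by (rule bounded_subset[of "{x, y}"]) auto
  ultimately show ?thesis using assms by (auto simp: riemann_maps_def)
qed

lemma geodesic_in: "\<lbrakk>x \<in> Y; y \<in> Y\<rbrakk> \<Longrightarrow> geodesic t x y \<in> Y"
  unfolding geodesic_def
  by (intro contracting_mean_in[OF contracting_mean_interval_mean] step_in_riemann_maps)

lemma geodesic_1:
  assumes "x \<in> Y" "y \<in> Y"
  shows "geodesic 1 x y = y"
proof -
  have "dist (geodesic 1 x y) (interval_mean (\<lambda>_. y)) \<le> 0"
    unfolding geodesic_def
    using assms step_in_riemann_maps[of y y]
    by (intro contracting_mean_uniform_dist_le[OF contracting_mean_interval_mean]
          prob_space_unit_interval step_in_riemann_maps)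
       (simp_all add: space_restrict_space)
  then show ?thesis using assms by (simp add: contracting_mean_const[OF contracting_mean_interval_mean])
qed

lemma dist_geodesics_le:
  assumes "x \<in> Y" "y \<in> Y" "x' \<in> Y" "y' \<in> Y" and A: "A \<in> sets borel"
    and r: "emeasure lborel A = ennreal r" "0 \<le> r"
    and le: "\<And>u. 0 < u \<Longrightarrow> dist (if u < s then y else x) (if u < t then y' else x') \<le> d * indicator A u"
      and d: "0 \<le> d"
  shows "dist (geodesic s x y) (geodesic t x' y') \<le> r * d"
proof -
  have "ennreal (dist (geodesic s x y) (geodesic t x' y'))
      \<le> (\<integral>\<^sup>+u. ennreal (d * indicator A u) \<partial>unit_interval)"
    unfolding geodesic_def
  proof (rule contracting_mean_dist_le[OF contracting_mean_interval_mean])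
    show "(\<lambda>u. ennreal (d * indicator A u)) \<in> borel_measurable unit_interval"
      using A by (intro measurable_restrict_space1) simp
  qed (use assms in \<open>auto intro!: step_in_riemann_maps ennreal_leI le simp: space_restrict_space\<close>)
  also have "\<dots> \<le> (\<integral>\<^sup>+u. ennreal d * indicator A u \<partial>lborel)"
    by (subst nn_integral_restrict_space) (auto intro!: nn_integral_mono split: split_indicator)
  also have "\<dots> = ennreal (r * d)"
    using A r d by (simp add: nn_integral_cmult_indicator ennreal_mult mult.commute)
  finally show ?thesis using r d by (simp add: ennreal_le_iff)
qed

lemma dist_geodesic_le:
  assumes "x \<in> Y" "y \<in> Y"
  shows "dist (geodesic s x y) (geodesic t x y) \<le> \<bar>s - t\<bar> * dist x y"
  using assms
  by (intro dist_geodesics_le[where A="{min s t..<max s t}"])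
     (auto simp: dist_commute max_def min_def split: split_indicator)

lemma geodesic_contract:
  assumes "x \<in> Y" "y \<in> Y" "y' \<in> Y" "0 \<le> t"
  shows "dist (geodesic t x y) (geodesic t x y') \<le> t * dist y y'"
  using assms by (intro dist_geodesics_le[where A="{0<..<t}"]) (auto split: split_indicator)

end

section \<open>The volume of the sphere\<close>

definition inner_prod :: "nat \<Rightarrow> (nat \<Rightarrow> real) \<Rightarrow> (nat \<Rightarrow> real) \<Rightarrow> real" where
  "inner_prod k x y = (\<Sum>i<k. x i * y i)"

definition sqnorm :: "nat \<Rightarrow> (nat \<Rightarrow> real) \<Rightarrow> real" where
  "sqnorm k x = (\<Sum>i<k. (x i)\<^sup>2)"

lemma sqnorm_nonneg: "0 \<le> sqnorm k x"
  by (simp add: sqnorm_def sum_nonneg)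

lemma sqnorm_Suc: "sqnorm (Suc n) x = sqnorm n x + (x n)\<^sup>2"
  by (simp add: sqnorm_def)

lemma sqnorm_scale: "sqnorm k (\<lambda>i. c * x i) = c\<^sup>2 * sqnorm k x"
  by (simp add: sqnorm_def power_mult_distrib sum_distrib_left)

lemma sqnorm_cong: "(\<And>i. i < k \<Longrightarrow> x i = y i) \<Longrightarrow> sqnorm k x = sqnorm k y"
  by (simp add: sqnorm_def)

lemma in_nsphere_iff: "q \<in> topspace (nsphere n) \<longleftrightarrow> (\<forall>i>n. q i = 0) \<and> sqnorm (Suc n) q = 1"
  by (auto simp: nsphere topspace_Euclidean_space sqnorm_def lessThan_Suc_atMost Suc_le_eq)

definition pole :: "nat \<Rightarrow> nat \<Rightarrow> real" where
  "pole n = (\<lambda>i. if i = n then 1 else 0)"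

lemma sqnorm_pole: "sqnorm (Suc n) (pole n) = 1"
proof -
  have "sqnorm n (pole n) = 0" unfolding sqnorm_def pole_def by (intro sum.neutral) auto
  then show ?thesis by (simp add: sqnorm_Suc pole_def)
qed

lemma pole_in_nsphere: "pole n \<in> topspace (nsphere n)"
  by (simp add: in_nsphere_iff sqnorm_pole) (simp add: pole_def)

text \<open>Sylvester's identity, from the two block triangularizations of
  \<open>(1 A; - B 1) (1 0; B 1)\<close> and of the product in the other order.\<close>

lemma det_one_plus_mult_commute:
  fixes A B :: "'a :: idom mat"
  assumes A: "A \<in> carrier_mat n k" and B: "B \<in> carrier_mat k n"
  shows "Determinant.det (1\<^sub>m n + A * B) = Determinant.det (1\<^sub>m k + B * A)"
proof -
  define X where "X = four_block_mat (1\<^sub>m n) A (- B) (1\<^sub>m k)"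
  define Z where "Z = four_block_mat (1\<^sub>m n) (0\<^sub>m n k) B (1\<^sub>m k)"
  have carrier: "X \<in> carrier_mat (n + k) (n + k)" "Z \<in> carrier_mat (n + k) (n + k)"
    using A B by (auto simp: X_def Z_def)
  have AB: "A * B \<in> carrier_mat n n" "B * A \<in> carrier_mat k k" using A B by auto
  have "X * Z = four_block_mat (1\<^sub>m n + A * B) A (0\<^sub>m k n) (1\<^sub>m k)"
    unfolding X_def Z_def using A B by (subst mult_four_block_mat[of _ n n _ k _ k _ _ n _ k]) auto
  then have XZ: "Determinant.det (X * Z) = Determinant.det (1\<^sub>m n + A * B)"
    using A AB det_four_block_mat_lower_left_zero[of "1\<^sub>m n + A * B" n A k "0\<^sub>m k n" "1\<^sub>m k"] by simp
  have "Z * X = four_block_mat (1\<^sub>m n) A (0\<^sub>m k n) (1\<^sub>m k + B * A)"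
    unfolding X_def Z_def using A B comm_add_mat[OF AB(2) one_carrier_mat]
    by (subst mult_four_block_mat[of _ n n _ k _ k _ _ n _ k]) auto
  then have ZX: "Determinant.det (Z * X) = Determinant.det (1\<^sub>m k + B * A)"
    using A AB det_four_block_mat_lower_left_zero[of "1\<^sub>m n" n A k "0\<^sub>m k n" "1\<^sub>m k + B * A"] by simp
  show ?thesis
    using det_mult[OF carrier] det_mult[OF carrier(2,1)]
    by (simp add: XZ[symmetric] ZX[symmetric] mult.commute)
qed

lemma det_id_plus_rank_one:
  fixes u :: "nat \<Rightarrow> real"
  shows "Determinant.det (mat n n (\<lambda>(i, j). (if i = j then 1 else 0) + c * u i * u j))
      = 1 + c * sqnorm n u"
proof -
  define A where "A = mat n 1 (\<lambda>(i, _). c * u i)"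
  define B where "B = mat 1 n (\<lambda>(_, j). u j)"
  have carrier: "A \<in> carrier_mat n 1" "B \<in> carrier_mat 1 n" by (simp_all add: A_def B_def)
  have "mat n n (\<lambda>(i, j). (if i = j then 1 else 0) + c * u i * u j) = 1\<^sub>m n + A * B"
    by (rule eq_matI) (auto simp: A_def B_def scalar_prod_def)
  moreover have "1\<^sub>m 1 + B * A = mat 1 1 (\<lambda>_. 1 + c * sqnorm n u)"
    by (rule eq_matI)
      (auto simp: A_def B_def scalar_prod_def sqnorm_def sum_distrib_left power2_eq_square mult_ac
        lessThan_atLeast0)
  ultimately show ?thesis
    using det_one_plus_mult_commute[OF carrier] by (simp add: det_single)
qed

lemma deriv_hemisphere_param:
  assumes "i < n" "k < n"
  shows "deriv (\<lambda>t. hemisphere_param n s (u(i := t)) k) (u i) = (if k = i then 1 else 0)"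
proof -
  have "(\<lambda>t. hemisphere_param n s (u(i := t)) k) = (\<lambda>t. if k = i then t else u k)"
    using assms by (auto simp: hemisphere_param_def)
  then show ?thesis by simp
qed

lemma deriv_hemisphere_param_height:
  assumes "i < n" "sqnorm n u < 1"
  shows "deriv (\<lambda>t. hemisphere_param n s (u(i := t)) n) (u i) = - s * u i / sqrt (1 - sqnorm n u)"
proof -
  define R where "R = (\<Sum>j\<in>{..<n} - {i}. (u j)\<^sup>2)"
  have sq: "sqnorm n (u(i := t)) = t\<^sup>2 + R" for t
    unfolding sqnorm_def R_def using assms(1) by (subst sum.remove[of _ i]) (auto intro!: sum.cong)
  have pos: "1 - ((u i)\<^sup>2 + R) = 1 - sqnorm n u" using sq[of "u i"] by simp
  have "((\<lambda>t. s * sqrt (1 - (t\<^sup>2 + R))) has_real_derivative - s * u i / sqrt (1 - sqnorm n u)) (at (u i))"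
    by (rule derivative_eq_intros refl | use pos assms in \<open>simp add: field_simps\<close>)+
  moreover have "(\<lambda>t. hemisphere_param n s (u(i := t)) n) = (\<lambda>t. s * sqrt (1 - (t\<^sup>2 + R)))"
    unfolding hemisphere_param_def sqnorm_def[symmetric] sq by simp
  ultimately show ?thesis by (simp add: DERIV_imp_deriv)
qed

lemma pullback_metric_hemisphere:
  assumes u: "sqnorm n u < 1" and s: "s\<^sup>2 = 1"
  shows "pullback_metric n (hemisphere_param n s) u
    = mat n n (\<lambda>(i, j). (if i = j then 1 else 0) + 1 / (1 - sqnorm n u) * u i * u j)"
  unfolding pullback_metric_def
proof (rule cong_mat[OF refl refl], unfold prod.case)
  fix i j assume ij: "i < n" "j < n"
  have "(\<Sum>k\<le>n. deriv (\<lambda>t. hemisphere_param n s (u(i := t)) k) (u i) *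
              deriv (\<lambda>t. hemisphere_param n s (u(j := t)) k) (u j)) =
    (\<Sum>k<n. (if k = i then 1 else 0) * (if k = j then 1 else 0)) +
      (- s * u i / sqrt (1 - sqnorm n u)) * (- s * u j / sqrt (1 - sqnorm n u))"
    using ij u
    by (simp add: lessThan_Suc_atMost[symmetric] deriv_hemisphere_param deriv_hemisphere_param_height)
  also have "(\<Sum>k<n. (if k = i then 1 else 0) * (if k = j then 1 else 0 :: real))
    = (\<Sum>k<n. if k = i then (if i = j then 1 else 0) else 0)"
    by (intro sum.cong) auto
  also have "\<dots> = (if i = j then 1 else 0)" using ij by simp
  also have "(- s * u i / sqrt (1 - sqnorm n u)) * (- s * u j / sqrt (1 - sqnorm n u))
    = s\<^sup>2 * (1 / (1 - sqnorm n u)) * u i * u j"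
    using u by (simp add: power2_eq_square)
  finally show "(\<Sum>k\<le>n. deriv (\<lambda>t. hemisphere_param n s (u(i := t)) k) (u i) *
              deriv (\<lambda>t. hemisphere_param n s (u(j := t)) k) (u j))
    = (if i = j then 1 else 0) + 1 / (1 - sqnorm n u) * u i * u j"
    by (simp only: s mult_1)
qed

lemma sqrt_det_pullback_metric_hemisphere:
  assumes "sqnorm n u < 1" "s\<^sup>2 = 1"
  shows "sqrt (Determinant.det (pullback_metric n (hemisphere_param n s) u)) = 1 / sqrt (1 - sqnorm n u)"
proof -
  have "1 + 1 / (1 - sqnorm n u) * sqnorm n u = 1 / (1 - sqnorm n u)"
    using assms(1) by (simp add: field_simps)
  then show ?thesis
    by (simp add: pullback_metric_hemisphere[OF assms] det_id_plus_rank_one real_sqrt_divide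
      del: times_divide_eq_left)
qed

lemma hemisphere_param_in_nsphere:
  assumes "sqnorm n u < 1" "s\<^sup>2 = 1"
  shows "hemisphere_param n s u \<in> topspace (nsphere n)"
proof -
  have "sqnorm n (hemisphere_param n s u) = sqnorm n u"
    by (rule sqnorm_cong) (simp add: hemisphere_param_def)
  moreover have "hemisphere_param n s u n = s * sqrt (1 - sqnorm n u)"
    by (simp add: hemisphere_param_def sqnorm_def)
  moreover have "hemisphere_param n s u i = 0" if "i > n" for i
    using that by (simp add: hemisphere_param_def)
  ultimately show ?thesis using assms by (simp add: in_nsphere_iff sqnorm_Suc power_mult_distrib)
qed

abbreviation coord_lborel :: "nat set \<Rightarrow> (nat \<Rightarrow> real) measure" where
  "coord_lborel I \<equiv> Pi\<^sub>M I (\<lambda>_. lborel)"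

interpretation lborel_product: product_sigma_finite "\<lambda>_::nat. lborel :: real measure"
  by standard

lemma measurable_sqnorm [measurable]: "sqnorm k \<in> borel_measurable (coord_lborel {..<k})"
  unfolding sqnorm_def by measurable

lemma measurable_hemisphere_param [measurable]: "hemisphere_param n s \<in> coord_lborel {..<n} \<rightarrow>\<^sub>M borel"
proof (rule measurable_coordinatewise_then_product)
  fix i
  consider "i < n" | "i = n" | "i > n" by linarith
  then show "(\<lambda>u. hemisphere_param n s u i) \<in> borel_measurable (coord_lborel {..<n})"
    by cases (simp_all add: hemisphere_param_def flip: sqnorm_def)
qed

definition hemisphere_weight :: "nat \<Rightarrow> (nat \<Rightarrow> real) \<Rightarrow> ennreal" where
  "hemisphere_weight n u = ennreal (1 / sqrt (1 - sqnorm n u)) * indicator {u. sqnorm n u < 1} u"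

lemma measurable_hemisphere_weight [measurable]:
  "hemisphere_weight n \<in> borel_measurable (coord_lborel {..<n})"
  unfolding hemisphere_weight_def by measurable

definition open_ball_volume :: "nat \<Rightarrow> (nat \<Rightarrow> real) measure" where
  "open_ball_volume n = restrict_space (coord_lborel {..<n}) {u. sqnorm n u < 1}"

lemma open_ball_volume_alt:
  fixes n :: nat
  defines "D \<equiv> {u \<in> space (coord_lborel {..<n}). sqnorm n u < 1}"
  shows "D \<in> sets (coord_lborel {..<n})"
    and "open_ball_volume n = restrict_space (coord_lborel {..<n}) D"
proof -
  show "D \<in> sets (coord_lborel {..<n})" unfolding D_def by measurable
  have "(\<inter>) {u. sqnorm n u < 1} ` sets (coord_lborel {..<n}) = (\<inter>) D ` sets (coord_lborel {..<n})"
    unfolding D_def by (intro image_cong refl) (use sets.sets_into_space in blast)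
  then show "open_ball_volume n = restrict_space (coord_lborel {..<n}) D"
    by (simp add: open_ball_volume_def restrict_space_def D_def Int_def conj_ac)
qed

lemma space_open_ball_volume: "u \<in> space (open_ball_volume n) \<Longrightarrow> sqnorm n u < 1"
  by (simp add: open_ball_volume_def space_restrict_space)

lemma sigma_finite_open_ball_volume: "sigma_finite_measure (open_ball_volume n)"
  using open_ball_volume_alt lborel_product.sigma_finite[of "{..<n}"]
  by (simp add: sigma_finite_measure_restrict_space)

lemma nn_integral_open_ball_volume:
  "(\<integral>\<^sup>+u. f u * hemisphere_weight n u \<partial>open_ball_volume n)
      = (\<integral>\<^sup>+u. f u * hemisphere_weight n u \<partial>coord_lborel {..<n})"
  unfolding open_ball_volume_alt(2) using open_ball_volume_alt(1)
  by (subst nn_integral_restrict_space)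
     (auto intro!: nn_integral_cong simp: hemisphere_weight_def split: split_indicator)

lemma measurable_open_ball_volume:
  assumes "\<And>s. f s \<in> coord_lborel {..<n} \<rightarrow>\<^sub>M N"
  shows "(\<lambda>(s, u). f s u) \<in> count_space {-1, 1 :: real} \<Otimes>\<^sub>M open_ball_volume n \<rightarrow>\<^sub>M N"
proof (rule measurable_pair_measure_countable1)
  fix s :: real
  show "(\<lambda>u. case (s, u) of (s, u) \<Rightarrow> f s u) \<in> open_ball_volume n \<rightarrow>\<^sub>M N"
    using assms by (simp add: open_ball_volume_def measurable_restrict_space1)
qed simp

lemma sphere_volume_eq:
  "sphere_volume n =
     distr (density (count_space {-1, 1} \<Otimes>\<^sub>M open_ball_volume n) (\<lambda>(s, u). hemisphere_weight n u))
       (restrict_space borel (topspace (nsphere n))) (\<lambda>(s, u). hemisphere_param n s u)"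
proof -
  let ?P = "count_space {-1, 1 :: real} \<Otimes>\<^sub>M open_ball_volume n"
  let ?w = "\<lambda>(s, u). ennreal (sqrt (Determinant.det (pullback_metric n (hemisphere_param n s) u)))"
  have eq: "?w z = (\<lambda>(s, u). hemisphere_weight n u) z" if "z \<in> space ?P" for z
    using that
    by (auto simp: space_pair_measure hemisphere_weight_def sqrt_det_pullback_metric_hemisphere
        dest!: space_open_ball_volume)
  have weight: "(\<lambda>(s, u). hemisphere_weight n u) \<in> borel_measurable ?P"
    by (rule measurable_open_ball_volume) measurable
  then have "?w \<in> borel_measurable ?P"
    by (rule measurable_cong[THEN iffD2, rotated]) (rule eq)
  then have "density ?P ?w = density ?P (\<lambda>(s, u). hemisphere_weight n u)"
    using weight by (intro density_cong) (auto intro: eq)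
  then show ?thesis by (simp add: sphere_volume_def open_ball_volume_def sqnorm_def)
qed

lemma space_sphere_volume: "space (sphere_volume n) = topspace (nsphere n)"
  by (simp add: sphere_volume_eq space_restrict_space)

lemma sets_sphere_volume: "sets (sphere_volume n) = sets (restrict_space borel (topspace (nsphere n)))"
  by (simp add: sphere_volume_eq)

lemma measurable_sphere_volume: "f \<in> borel \<rightarrow>\<^sub>M N \<Longrightarrow> f \<in> sphere_volume n \<rightarrow>\<^sub>M N"
  unfolding measurable_cong_sets[OF sets_sphere_volume refl] by (rule measurable_restrict_space1)

lemma nn_integral_sphere_volume:
  assumes G[measurable]: "G \<in> borel_measurable borel"
  shows "(\<integral>\<^sup>+x. G x \<partial>sphere_volume n) =
    (\<Sum>s\<in>{-1, 1}. \<integral>\<^sup>+u. G (hemisphere_param n s u) * hemisphere_weight n u \<partial>coord_lborel {..<n})"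
proof -
  interpret ball: sigma_finite_measure "open_ball_volume n" by (rule sigma_finite_open_ball_volume)
  let ?P = "count_space {-1, 1 :: real} \<Otimes>\<^sub>M open_ball_volume n"
  let ?\<phi> = "\<lambda>(s, u). hemisphere_param n s u"
  have param: "?\<phi> \<in> ?P \<rightarrow>\<^sub>M restrict_space borel (topspace (nsphere n))"
  proof (rule measurable_restrict_space2)
    show "?\<phi> \<in> space ?P \<rightarrow> topspace (nsphere n)"
      by (auto simp: space_pair_measure intro!: hemisphere_param_in_nsphere
        dest!: space_open_ball_volume)
  qed (rule measurable_open_ball_volume, measurable)
  have weight: "(\<lambda>(s, u). hemisphere_weight n u) \<in> borel_measurable ?P"
    by (rule measurable_open_ball_volume) measurable
  have Gw: "(\<lambda>(s, u). G (hemisphere_param n s u) * hemisphere_weight n u) \<in> borel_measurable ?P"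
    by (rule measurable_open_ball_volume) measurable
  have G': "G \<in> borel_measurable (restrict_space borel (topspace (nsphere n)))"
    by (rule measurable_restrict_space1) measurable
  have "(\<integral>\<^sup>+x. G x \<partial>sphere_volume n) = (\<integral>\<^sup>+z. (\<lambda>(s, u). hemisphere_weight n u) z * G (?\<phi> z) \<partial>?P)"
    unfolding sphere_volume_eq using param G' weight measurable_compose[OF param G']
    by (simp add: nn_integral_distr nn_integral_density measurable_density_eq1)
  also have "\<dots> = (\<integral>\<^sup>+z. (\<lambda>(s, u). G (hemisphere_param n s u) * hemisphere_weight n u) z \<partial>?P)"
    by (rule nn_integral_cong) (auto simp: mult.commute)
  also have "\<dots> = (\<integral>\<^sup>+s. \<integral>\<^sup>+u. G (hemisphere_param n s u) * hemisphere_weight n u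
      \<partial>open_ball_volume n \<partial>count_space {-1, 1})"
    by (subst ball.nn_integral_fst[OF Gw, symmetric]) simp
  also have "\<dots>
      = (\<Sum>s\<in>{-1, 1}. \<integral>\<^sup>+u. G (hemisphere_param n s u) * hemisphere_weight n u \<partial>open_ball_volume n)"
    by (rule nn_integral_count_space_finite) simp
  finally show ?thesis by (simp only: nn_integral_open_ball_volume)
qed

lemma nn_integral_sphere_volume_0:
  assumes "G \<in> borel_measurable borel"
  shows "(\<integral>\<^sup>+x. G x \<partial>sphere_volume 0) = G (\<lambda>i. - pole 0 i) + G (pole 0)"
proof -
  have "hemisphere_param 0 s u = (\<lambda>i. s * pole 0 i)" "hemisphere_weight 0 u = 1" for s u
    by (auto simp: hemisphere_param_def hemisphere_weight_def sqnorm_def pole_def)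
  then show ?thesis by (simp add: nn_integral_sphere_volume[OF assms] PiM_empty)
qed

lemma distr_PiM_lborel_scale:
  assumes "finite I" and r: "0 < (r::real)"
  shows "density (distr (coord_lborel I) (coord_lborel I) (\<lambda>x. \<lambda>i\<in>I. r * x i)) (\<lambda>_. ennreal (r ^ card I))
    = coord_lborel I" (is "density ?D _ = _")
proof (rule lborel_product.PiM_eqI)
  have [measurable]: "(\<lambda>x. \<lambda>i\<in>I. r * x i) \<in> coord_lborel I \<rightarrow>\<^sub>M coord_lborel I"
    by (intro measurable_restrict) measurable
  fix A :: "nat \<Rightarrow> real set" assume A: "\<And>i. i \<in> I \<Longrightarrow> A i \<in> sets lborel"
  have scale: "ennreal r * emeasure lborel ((\<lambda>x. r * x) -` B) = emeasure lborel B"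
    if B: "B \<in> sets borel" for B
  proof -
    have "emeasure lborel B = ennreal r * emeasure (distr lborel borel ((*) r)) B"
      using r B by (subst lborel_distr_mult'[of r]) (simp_all add: emeasure_density_const)
    then show ?thesis using B by (simp add: emeasure_distr)
  qed
  have vimage: "(\<lambda>x. r * x) -` B \<in> sets borel" if "B \<in> sets borel" for B
    using measurable_sets[of "\<lambda>x. r * x" borel borel B] that by simp
  have box: "PiE I A \<in> sets (coord_lborel I)" using assms(1) A by (intro sets_PiM_I_finite) auto
  have "(\<lambda>x. \<lambda>i\<in>I. r * x i) -` PiE I A \<inter> space (coord_lborel I) = PiE I (\<lambda>i. (\<lambda>x. r * x) -` A i)"
    by (auto simp: space_PiM PiE_iff)
  then have "emeasure (density ?D (\<lambda>_. ennreal (r ^ card I))) (PiE I A)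
    = ennreal (r ^ card I) * emeasure (coord_lborel I) (PiE I (\<lambda>i. (\<lambda>x. r * x) -` A i))"
    using box by (simp add: emeasure_density_const emeasure_distr)
  also have "\<dots> = (\<Prod>i\<in>I. ennreal r * emeasure lborel ((\<lambda>x. r * x) -` A i))"
    using assms(1) A r
    by (subst lborel_product.emeasure_PiM) (auto simp: prod.distrib ennreal_power vimage)
  also have "\<dots> = (\<Prod>i\<in>I. emeasure lborel (A i))"
    using A by (intro prod.cong refl scale) simp
  finally show "emeasure (density ?D (\<lambda>_. ennreal (r ^ card I))) (PiE I A)
      = (\<Prod>i\<in>I. emeasure lborel (A i))" .
qed (use assms in simp_all)

lemma nn_integral_coord_scale:
  assumes "finite I" and F: "F \<in> borel_measurable (coord_lborel I)" and r: "0 < (r::real)"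
  shows "(\<integral>\<^sup>+x. F x \<partial>coord_lborel I) = ennreal (r ^ card I) * (\<integral>\<^sup>+x. F (\<lambda>i\<in>I. r * x i) \<partial>coord_lborel I)"
proof -
  have "(\<lambda>x. \<lambda>i\<in>I. r * x i) \<in> coord_lborel I \<rightarrow>\<^sub>M coord_lborel I"
    by (intro measurable_restrict) measurable
  then show ?thesis
    using F by (subst distr_PiM_lborel_scale[OF assms(1) r, symmetric])
      (simp add: nn_integral_density nn_integral_cmult nn_integral_distr)
qed

lemma vimage_permute_PiE:
  assumes f: "f permutes I" and A: "\<And>i. i \<in> I \<Longrightarrow> A i \<subseteq> S"
  defines "g \<equiv> inv_into UNIV f"
  shows "(\<lambda>x. \<lambda>i\<in>I. x (f i)) -` PiE I A \<inter> (I \<rightarrow>\<^sub>E S) = PiE I (\<lambda>i. A (g i))"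
proof (intro equalityI subsetI)
  have f_in: "f i \<in> I \<longleftrightarrow> i \<in> I" and g_in: "g i \<in> I \<longleftrightarrow> i \<in> I" for i
    unfolding g_def using permutes_in_image[OF f] permutes_in_image[OF permutes_inv[OF f]] by simp_all
  have fg: "f (g i) = i" and gf: "g (f i) = i" for i
    unfolding g_def by (rule permutes_inverses[OF f])+
  {
    fix x assume "x \<in> (\<lambda>x. \<lambda>i\<in>I. x (f i)) -` PiE I A \<inter> (I \<rightarrow>\<^sub>E S)"
    then have "x \<in> extensional I" and x: "\<And>i. i \<in> I \<Longrightarrow> x (f i) \<in> A i" by (auto simp: PiE_iff)
    moreover have "x i \<in> A (g i)" if "i \<in> I" for i using x[of "g i"] that g_in fg by simp
    ultimately show "x \<in> PiE I (\<lambda>i. A (g i))" by (simp add: PiE_iff)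
  next
    fix x assume x: "x \<in> PiE I (\<lambda>i. A (g i))"
    then have "x i \<in> S" if "i \<in> I" for i using that A[of "g i"] g_in by (auto simp: PiE_iff)
    moreover have "x (f i) \<in> A i" if "i \<in> I" for i using x f_in that gf by (force simp: PiE_iff)
    ultimately show "x \<in> (\<lambda>x. \<lambda>i\<in>I. x (f i)) -` PiE I A \<inter> (I \<rightarrow>\<^sub>E S)"
      using x by (auto simp: PiE_iff)
  }
qed

lemma distr_PiM_permute:
  assumes "finite I" and f: "f permutes I" and "sigma_finite_measure M"
  shows "distr (Pi\<^sub>M I (\<lambda>_. M)) (Pi\<^sub>M I (\<lambda>_. M)) (\<lambda>x. \<lambda>i\<in>I. x (f i)) = Pi\<^sub>M I (\<lambda>_. M)"
    (is "?D = _")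
proof -
  interpret product_sigma_finite "\<lambda>_. M" using assms(3) by (simp add: product_sigma_finite_def)
  show ?thesis
  proof (rule PiM_eqI)
    have [measurable]: "(\<lambda>x. \<lambda>i\<in>I. x (f i)) \<in> Pi\<^sub>M I (\<lambda>_. M) \<rightarrow>\<^sub>M Pi\<^sub>M I (\<lambda>_. M)"
      using permutes_in_image[OF f] by (intro measurable_restrict measurable_component_singleton) simp
    fix A assume A: "\<And>i. i \<in> I \<Longrightarrow> A i \<in> sets M"
    define g where "g = inv_into UNIV f"
    have g: "g permutes I" unfolding g_def using f by (rule permutes_inv)
    have "(\<lambda>x. \<lambda>i\<in>I. x (f i)) -` PiE I A \<inter> space (Pi\<^sub>M I (\<lambda>_. M)) = PiE I (\<lambda>i. A (g i))"
      unfolding space_PiM g_def by (rule vimage_permute_PiE[OF f sets.sets_into_space[OF A]])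
    then have "emeasure ?D (PiE I A) = emeasure (Pi\<^sub>M I (\<lambda>_. M)) (PiE I (\<lambda>i. A (g i)))"
      using assms(1) A by (subst emeasure_distr) (auto intro!: sets_PiM_I_finite)
    also have "\<dots> = (\<Prod>i\<in>I. emeasure M (A (g i)))"
      using assms(1) A permutes_in_image[OF g] by (intro emeasure_PiM) auto
    also have "\<dots> = (\<Prod>i\<in>I. emeasure M (A i))"
      using prod.permute[OF g, of "\<lambda>i. emeasure M (A i)"] by (simp add: comp_def)
    finally show "emeasure ?D (PiE I A) = (\<Prod>i\<in>I. emeasure M (A i))" .
  qed (use assms(1) in simp_all)
qed

definition direction :: "nat \<Rightarrow> (nat \<Rightarrow> real) \<Rightarrow> nat \<Rightarrow> real" where
  "direction n x = (if sqnorm (Suc n) x = 0 then pole n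
     else (\<lambda>i. if i \<le> n then x i / sqrt (sqnorm (Suc n) x) else 0))"

lemma direction_in_nsphere: "direction n x \<in> topspace (nsphere n)"
proof (cases "sqnorm (Suc n) x = 0")
  case True
  then show ?thesis by (simp add: direction_def pole_in_nsphere)
next
  case False
  let ?r = "sqrt (sqnorm (Suc n) x)"
  have "sqnorm (Suc n) (direction n x) = sqnorm (Suc n) (\<lambda>i. 1 / ?r * x i)"
    using False by (intro sqnorm_cong) (simp add: direction_def)
  also have "\<dots> = 1" using False sqnorm_nonneg[of "Suc n" x]
    by (simp only: sqnorm_scale) (simp add: power_divide)
  finally show ?thesis using False by (simp add: in_nsphere_iff) (simp add: direction_def)
qed

lemma sqrt_sqnorm_times_direction:
  assumes "i \<le> n"
  shows "sqrt (sqnorm (Suc n) x) * direction n x i = x i"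
proof (cases "sqnorm (Suc n) x = 0")
  case True
  then have "\<forall>i\<in>{..<Suc n}. (x i)\<^sup>2 = 0"
    unfolding sqnorm_def by (subst (asm) sum_nonneg_eq_0_iff) auto
  then show ?thesis using True assms by (simp add: less_Suc_eq_le)
qed (use assms in \<open>simp add: direction_def\<close>)

lemma direction_nsphere: "x \<in> topspace (nsphere n) \<Longrightarrow> direction n x = x"
  by (auto simp: in_nsphere_iff direction_def fun_eq_iff)

section \<open>Slicing the sphere\<close>

definition slice :: "nat \<Rightarrow> real \<Rightarrow> real \<Rightarrow> (nat \<Rightarrow> real) \<Rightarrow> nat \<Rightarrow> real" where
  "slice n c s y = (\<lambda>i. c * y i)(n := s, Suc n := c * y n)"

lemma sqnorm_slice: "sqnorm (Suc (Suc n)) (slice n c s y) = c\<^sup>2 * sqnorm (Suc n) y + s\<^sup>2"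
proof -
  have "sqnorm n (slice n c s y) = sqnorm n (\<lambda>i. c * y i)"
    by (rule sqnorm_cong) (simp add: slice_def)
  then show ?thesis
    by (simp add: sqnorm_Suc sqnorm_scale) (simp add: slice_def power_mult_distrib distrib_left)
qed

lemma slice_in_nsphere:
  assumes "y \<in> topspace (nsphere n)" "c\<^sup>2 + s\<^sup>2 = 1"
  shows "slice n c s y \<in> topspace (nsphere (Suc n))"
  using assms by (simp add: in_nsphere_iff sqnorm_slice) (simp add: slice_def)

lemma inner_prod_slice:
  "inner_prod (Suc (Suc n)) (slice n c s x) (slice n c' s' y) = c * c' * inner_prod (Suc n) x y + s * s'"
proof -
  have "(\<Sum>i<n. slice n c s x i * slice n c' s' y i) = (\<Sum>i<n. c * c' * (x i * y i))"
    by (intro sum.cong) (simp_all add: slice_def mult_ac)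
  then have "inner_prod n (slice n c s x) (slice n c' s' y) = c * c' * inner_prod n x y"
    by (simp add: inner_prod_def sum_distrib_left)
  then show ?thesis by (simp add: inner_prod_def slice_def algebra_simps)
qed

lemma nsphere_Suc_slice:
  assumes "q \<in> topspace (nsphere (Suc n))"
  obtains t p where "p \<in> topspace (nsphere n)" "q = slice n (cos t) (sin t) p"
proof
  define w where "w = q(n := q (Suc n), Suc n := 0)"
  have "sqnorm n w = sqnorm n q" by (rule sqnorm_cong) (simp add: w_def)
  then have w: "sqnorm (Suc n) w + (q n)\<^sup>2 = 1"
    using assms by (simp add: in_nsphere_iff sqnorm_Suc) (simp add: w_def)
  then have "(q n)\<^sup>2 \<le> 1" using sqnorm_nonneg[of "Suc n" w] by linarith
  then have "\<bar>q n\<bar> \<le> 1" by (simp add: abs_square_le_1)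
  then have sin: "sin (arcsin (q n)) = q n" and cos: "cos (arcsin (q n)) = sqrt (sqnorm (Suc n) w)"
    using w by (simp_all add: cos_arcsin abs_le_iff eq_diff_eq)
  show "direction n w \<in> topspace (nsphere n)" by (rule direction_in_nsphere)
  have "sqrt (sqnorm (Suc n) w) * direction n w i = w i" for i
  proof (cases "i \<le> n")
    case False
    then show ?thesis using assms direction_in_nsphere[of n w] by (auto simp: in_nsphere_iff w_def)
  qed (rule sqrt_sqnorm_times_direction)
  then show "q = slice n (cos (arcsin (q n))) (sin (arcsin (q n))) (direction n w)"
    unfolding slice_def sin cos by (auto simp: w_def)
qed

lemma measurable_slice [measurable (raw)]:
  assumes [measurable]: "c \<in> borel_measurable M" "s \<in> borel_measurable M" and y: "y \<in> M \<rightarrow>\<^sub>M borel"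
  shows "(\<lambda>x. slice n (c x) (s x) (y x)) \<in> M \<rightarrow>\<^sub>M borel"
proof (rule measurable_coordinatewise_then_product)
  have [measurable]: "(\<lambda>x. y x i) \<in> borel_measurable M" for i
    using measurable_product_then_coordinatewise[OF y] .
  show "(\<lambda>x. slice n (c x) (s x) (y x) i) \<in> borel_measurable M" for i
    by (cases "i = n"; cases "i = Suc n") (simp_all add: slice_def)
qed

definition ball_slice :: "nat \<Rightarrow> real \<Rightarrow> (nat \<Rightarrow> real) \<Rightarrow> nat \<Rightarrow> real" where
  "ball_slice n t w = (\<lambda>i\<in>{..<n}. sqrt (1 - t\<^sup>2) * w i)(n := t)"

lemma one_minus_sqnorm_ball_slice:
  assumes "\<bar>t\<bar> \<le> 1"
  shows "1 - sqnorm (Suc n) (ball_slice n t w) = (1 - t\<^sup>2) * (1 - sqnorm n w)"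
proof -
  have "sqnorm n (ball_slice n t w) = sqnorm n (\<lambda>i. sqrt (1 - t\<^sup>2) * w i)"
    by (rule sqnorm_cong) (simp add: ball_slice_def)
  moreover have "t\<^sup>2 \<le> 1" using assms by (simp add: abs_square_le_1)
  ultimately show ?thesis
    by (simp add: sqnorm_Suc sqnorm_scale) (simp add: ball_slice_def algebra_simps)
qed

lemma hemisphere_param_ball_slice:
  assumes "\<bar>t\<bar> \<le> 1"
  shows "hemisphere_param (Suc n) s (ball_slice n t w)
      = slice n (sqrt (1 - t\<^sup>2)) t (hemisphere_param n s w)"
proof
  fix i
  have "hemisphere_param (Suc n) s (ball_slice n t w) (Suc n)
      = s * sqrt (1 - sqnorm (Suc n) (ball_slice n t w))"
    by (simp add: hemisphere_param_def sqnorm_def)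
  also have "\<dots> = sqrt (1 - t\<^sup>2) * (s * sqrt (1 - sqnorm n w))"
    unfolding one_minus_sqnorm_ball_slice[OF assms] by (simp add: real_sqrt_mult)
  finally have "hemisphere_param (Suc n) s (ball_slice n t w) (Suc n)
      = sqrt (1 - t\<^sup>2) * (s * sqrt (1 - sqnorm n w))" .
  then show "hemisphere_param (Suc n) s (ball_slice n t w) i
      = slice n (sqrt (1 - t\<^sup>2)) t (hemisphere_param n s w) i"
    by (cases "i = Suc n")
       (simp_all add: slice_def sqnorm_def, simp_all add: hemisphere_param_def ball_slice_def)
qed

lemma hemisphere_weight_ball_slice:
  assumes "\<bar>t\<bar> < 1"
  shows "hemisphere_weight (Suc n) (ball_slice n t w)
      = hemisphere_weight n w * ennreal (1 / sqrt (1 - t\<^sup>2))"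
proof -
  have t: "1 - t\<^sup>2 > 0" using assms by (simp add: abs_square_less_1)
  have sq: "1 - sqnorm (Suc n) (ball_slice n t w) = (1 - t\<^sup>2) * (1 - sqnorm n w)"
    using assms by (intro one_minus_sqnorm_ball_slice) simp
  then have "sqnorm (Suc n) (ball_slice n t w) < 1 \<longleftrightarrow> 0 < (1 - t\<^sup>2) * (1 - sqnorm n w)"
    by linarith
  also have "\<dots> \<longleftrightarrow> sqnorm n w < 1" using t by (simp add: zero_less_mult_iff)
  finally show ?thesis
    using t by (auto simp: hemisphere_weight_def sq real_sqrt_mult mult.commute
      simp flip: ennreal_mult split: split_indicator)
qed

lemma nn_integral_hemisphere_slice:
  assumes G[measurable]: "G \<in> borel_measurable borel"
  defines "r \<equiv> \<lambda>t::real. sqrt (1 - t\<^sup>2)"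
  shows "(\<integral>\<^sup>+v. G (hemisphere_param (Suc n) s (v(n := t))) * hemisphere_weight (Suc n) (v(n := t))
      \<partial>coord_lborel {..<n})
    = ennreal (r t ^ n) * ennreal (1 / r t) * indicator {-1<..<1} t *
      (\<integral>\<^sup>+w. G (slice n (r t) t (hemisphere_param n s w)) * hemisphere_weight n w \<partial>coord_lborel {..<n})"
proof (cases "\<bar>t\<bar> < 1")
  case True
  then have r: "r t > 0" by (simp add: r_def abs_square_less_1)
  define F where
    "F v = G (hemisphere_param (Suc n) s (v(n := t))) * hemisphere_weight (Suc n) (v(n := t))" for v
  have F_scale: "F (\<lambda>i\<in>{..<n}. r t * w i)
      = ennreal (1 / r t) * (G (slice n (r t) t (hemisphere_param n s w)) * hemisphere_weight n w)" for w
  proof -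
    have "F (\<lambda>i\<in>{..<n}. r t * w i)
      = G (hemisphere_param (Suc n) s (ball_slice n t w)) * hemisphere_weight (Suc n) (ball_slice n t w)"
      by (simp only: F_def r_def ball_slice_def)
    then show ?thesis
      using True by (simp add: hemisphere_param_ball_slice hemisphere_weight_ball_slice r_def mult_ac)
  qed
  have "(\<lambda>v. v(n := t)) \<in> coord_lborel {..<n} \<rightarrow>\<^sub>M coord_lborel {..<Suc n}"
    by (rule measurable_fun_upd[where J="{..<n}"]) auto
  then have "F \<in> borel_measurable (coord_lborel {..<n})" unfolding F_def by measurable
  then have "(\<integral>\<^sup>+v. F v \<partial>coord_lborel {..<n})
      = ennreal (r t ^ n) * (\<integral>\<^sup>+w. F (\<lambda>i\<in>{..<n}. r t * w i) \<partial>coord_lborel {..<n})"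
    using nn_integral_coord_scale[of "{..<n}" F "r t"] r by simp
  also have "(\<integral>\<^sup>+w. F (\<lambda>i\<in>{..<n}. r t * w i) \<partial>coord_lborel {..<n})
    = ennreal (1 / r t) *
      (\<integral>\<^sup>+w. G (slice n (r t) t (hemisphere_param n s w)) * hemisphere_weight n w \<partial>coord_lborel {..<n})"
    unfolding F_scale by (rule nn_integral_cmult) measurable
  finally show ?thesis using True by (simp add: F_def mult.assoc abs_less_iff)
next
  case False
  then have "1 \<le> t\<^sup>2" by (simp add: abs_square_less_1 not_less[symmetric])
  then have "hemisphere_weight (Suc n) (v(n := t)) = 0" for v
    using sqnorm_nonneg[of n "v(n := t)"] by (simp add: hemisphere_weight_def sqnorm_Suc)
  then show ?thesis using False by (auto split: split_indicator)
qed

lemma nn_integral_sin_substitution: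
  fixes g :: "real \<Rightarrow> ennreal"
  assumes [measurable]: "g \<in> borel_measurable borel"
  shows "(\<integral>\<^sup>+t\<in>{-1<..<1}. g t * ennreal (1 / sqrt (1 - t\<^sup>2)) \<partial>lborel)
      = (\<integral>\<^sup>+\<theta>\<in>{- (pi/2)<..<pi/2}. g (sin \<theta>) \<partial>lborel)"
proof -
  let ?f = "\<lambda>t. g t * ennreal (1 / sqrt (1 - t\<^sup>2))"
  have "(\<integral>\<^sup>+t\<in>{-1<..<1}. ?f t \<partial>lborel) = (\<integral>\<^sup>+t. ?f t * indicator {sin (- (pi/2))..sin (pi/2)} t \<partial>lborel)"
    by (intro nn_integral_cong) (auto simp: le_less split: split_indicator)
  also have "\<dots> = (\<integral>\<^sup>+\<theta>. ?f (sin \<theta>) * ennreal (cos \<theta>) * indicator {- (pi/2)..pi/2} \<theta> \<partial>lborel)"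
    by (rule nn_integral_substitution_aux)
       (auto intro!: derivative_eq_intros continuous_intros simp: cos_ge_zero)
  also have "\<dots> = (\<integral>\<^sup>+\<theta>\<in>{- (pi/2)<..<pi/2}. g (sin \<theta>) \<partial>lborel)"
  proof (rule nn_integral_cong)
    fix \<theta>
    consider "- (pi/2) < \<theta>" "\<theta> < pi/2" | "\<theta> = - (pi/2) \<or> \<theta> = pi/2" | "\<theta> < - (pi/2) \<or> pi/2 < \<theta>"
      by linarith
    then show "?f (sin \<theta>) * ennreal (cos \<theta>) * indicator {- (pi/2)..pi/2} \<theta>
        = g (sin \<theta>) * indicator {- (pi/2)<..<pi/2} \<theta>"
    proof cases
      case 1
      then have "cos \<theta> > 0" by (simp add: cos_gt_zero_pi)
      moreover have "sqrt (1 - (sin \<theta>)\<^sup>2) = \<bar>cos \<theta>\<bar>" by (simp flip: cos_squared_eq)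
      ultimately have "ennreal (1 / sqrt (1 - (sin \<theta>)\<^sup>2)) * ennreal (cos \<theta>) = 1"
        by (simp flip: ennreal_mult)
      then show ?thesis using 1 by (simp add: mult.assoc)
    next
      case 2
      then have "cos \<theta> = 0" by (metis cos_minus cos_pi_half)
      then show ?thesis using 2 by auto
    qed auto
  qed
  finally show ?thesis .
qed

lemma measurable_nn_integral_hemisphere_slice:
  assumes [measurable]: "G \<in> borel_measurable borel"
      "c \<in> borel_measurable borel" "s \<in> borel_measurable borel"
  shows "(\<lambda>t. \<integral>\<^sup>+w. G (slice n (c t) (s t) (hemisphere_param n \<sigma> w)) * hemisphere_weight n w
    \<partial>coord_lborel {..<n}) \<in> borel_measurable borel"
  by (rule sigma_finite_measure.borel_measurable_nn_integral[OF lborel_product.sigma_finite])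
    (simp, measurable)

lemma nn_integral_sphere_volume_slice:
  assumes [measurable]: "G \<in> borel_measurable borel"
  shows "(\<integral>\<^sup>+y. G (slice n c s y) \<partial>sphere_volume n) =
    (\<Sum>\<sigma>\<in>{-1, 1}. \<integral>\<^sup>+w. G (slice n c s (hemisphere_param n \<sigma> w)) * hemisphere_weight n w
      \<partial>coord_lborel {..<n})"
  by (rule nn_integral_sphere_volume) measurable

lemma measurable_nn_integral_slice:
  assumes "G \<in> borel_measurable borel" "c \<in> borel_measurable borel" "s \<in> borel_measurable borel"
  shows "(\<lambda>t. \<integral>\<^sup>+y. G (slice n (c t) (s t) y) \<partial>sphere_volume n) \<in> borel_measurable borel"
  using measurable_nn_integral_hemisphere_slice[OF assms]
  by (simp add: nn_integral_sphere_volume_slice assms(1))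

lemma nn_integral_sphere_volume_height:
  assumes G[measurable]: "G \<in> borel_measurable borel"
  defines "r \<equiv> \<lambda>t::real. sqrt (1 - t\<^sup>2)"
  shows "(\<integral>\<^sup>+x. G x \<partial>sphere_volume (Suc n)) =
    (\<integral>\<^sup>+t\<in>{-1<..<1}. ennreal (r t ^ n) * (\<integral>\<^sup>+y. G (slice n (r t) t y) \<partial>sphere_volume n)
      * ennreal (1 / r t) \<partial>lborel)"
proof -
  have r[measurable]: "r \<in> borel_measurable borel" unfolding r_def by measurable
  have Suc_n: "{..<Suc n} = insert n {..<n}" by auto
  define I where "I s t = (\<integral>\<^sup>+w. G (slice n (r t) t (hemisphere_param n s w)) * hemisphere_weight n w
    \<partial>coord_lborel {..<n})" for s t
  have [measurable]: "I s \<in> borel_measurable borel" for s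
    unfolding I_def by (rule measurable_nn_integral_hemisphere_slice) measurable
  have "(\<integral>\<^sup>+u. G (hemisphere_param (Suc n) s u) * hemisphere_weight (Suc n) u \<partial>coord_lborel {..<Suc n})
    = (\<integral>\<^sup>+t. ennreal (r t ^ n) * ennreal (1 / r t) * indicator {-1<..<1} t * I s t \<partial>lborel)" for s
  proof -
    have [measurable]: "(\<lambda>u. G (hemisphere_param (Suc n) s u) * hemisphere_weight (Suc n) u)
        \<in> borel_measurable (coord_lborel (insert n {..<n}))"
      unfolding Suc_n[symmetric] by measurable
    show ?thesis
      unfolding Suc_n
      by (subst lborel_product.product_nn_integral_insert_rev)
        (simp_all add: nn_integral_hemisphere_slice I_def r_def)
  qed
  then have "(\<integral>\<^sup>+x. G x \<partial>sphere_volume (Suc n))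
    = (\<integral>\<^sup>+t. (\<Sum>s\<in>{-1, 1}. ennreal (r t ^ n) * ennreal (1 / r t) * indicator {-1<..<1} t * I s t) \<partial>lborel)"
    by (simp add: nn_integral_sphere_volume nn_integral_add)
  also have "\<dots> = (\<integral>\<^sup>+t\<in>{-1<..<1}. ennreal (r t ^ n) * (\<Sum>s\<in>{-1, 1}. I s t) * ennreal (1 / r t) \<partial>lborel)"
    by (intro nn_integral_cong) (simp add: distrib_left distrib_right mult_ac)
  finally show ?thesis by (simp only: nn_integral_sphere_volume_slice[OF G] I_def)
qed

abbreviation latitudes :: "real set" where
  "latitudes \<equiv> {- (pi/2)<..<pi/2}"

abbreviation at_latitude :: "nat \<Rightarrow> real \<Rightarrow> (nat \<Rightarrow> real) \<Rightarrow> nat \<Rightarrow> real" where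
  "at_latitude n \<theta> \<equiv> slice n (cos \<theta>) (sin \<theta>)"

lemma nn_integral_sphere_volume_Suc:
  assumes G[measurable]: "G \<in> borel_measurable borel"
  shows "(\<integral>\<^sup>+x. G x \<partial>sphere_volume (Suc n)) =
    (\<integral>\<^sup>+\<theta>\<in>latitudes. ennreal (cos \<theta> ^ n) * (\<integral>\<^sup>+y. G (at_latitude n \<theta> y) \<partial>sphere_volume n) \<partial>lborel)"
proof -
  define g where
    "g t = ennreal (sqrt (1 - t\<^sup>2) ^ n) * (\<integral>\<^sup>+y. G (slice n (sqrt (1 - t\<^sup>2)) t y) \<partial>sphere_volume n)" for t
  have [measurable]:
    "(\<lambda>t. \<integral>\<^sup>+y. G (slice n (sqrt (1 - t\<^sup>2)) t y) \<partial>sphere_volume n) \<in> borel_measurable borel"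
    by (rule measurable_nn_integral_slice) measurable
  have [measurable]: "g \<in> borel_measurable borel" unfolding g_def by measurable
  have "(\<integral>\<^sup>+x. G x \<partial>sphere_volume (Suc n)) = (\<integral>\<^sup>+t\<in>{-1<..<1}. g t * ennreal (1 / sqrt (1 - t\<^sup>2)) \<partial>lborel)"
    unfolding g_def by (rule nn_integral_sphere_volume_height[OF G])
  also have "\<dots> = (\<integral>\<^sup>+\<theta>\<in>latitudes. g (sin \<theta>) \<partial>lborel)"
    by (rule nn_integral_sin_substitution) measurable
  also have "\<dots>
      = (\<integral>\<^sup>+\<theta>\<in>latitudes. ennreal (cos \<theta> ^ n) * (\<integral>\<^sup>+y. G (at_latitude n \<theta> y) \<partial>sphere_volume n) \<partial>lborel)"
  proof (rule nn_integral_cong)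
    fix \<theta> :: real
    have "sqrt (1 - (sin \<theta>)\<^sup>2) = cos \<theta>" if "\<theta> \<in> latitudes"
      using that cos_gt_zero_pi[of \<theta>] by (simp flip: cos_squared_eq)
    then show "g (sin \<theta>) * indicator latitudes \<theta>
      = ennreal (cos \<theta> ^ n) * (\<integral>\<^sup>+y. G (at_latitude n \<theta> y) \<partial>sphere_volume n) * indicator latitudes \<theta>"
      by (simp only: g_def split: split_indicator) simp
  qed
  finally show ?thesis .
qed

lemma nn_integral_cos_power:
  obtains Z where "0 < Z" "(\<integral>\<^sup>+\<theta>\<in>latitudes. ennreal (cos \<theta> ^ n) \<partial>lborel) = ennreal Z"
proof -
  let ?Z = "\<integral>\<^sup>+\<theta>\<in>latitudes. ennreal (cos \<theta> ^ n) \<partial>lborel"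
  have "?Z \<le> (\<integral>\<^sup>+\<theta>. indicator latitudes \<theta> \<partial>lborel)"
    by (intro nn_integral_mono)
      (auto simp: cos_gt_zero_pi less_imp_le power_le_one split: split_indicator)
  then have "?Z \<noteq> \<infinity>" by (auto simp: top_unique)
  moreover have "?Z \<noteq> 0"
  proof
    assume "?Z = 0"
    then have "AE \<theta> in lborel. ennreal (cos \<theta> ^ n) * indicator latitudes \<theta> = 0"
      by (subst (asm) nn_integral_0_iff_AE) auto
    then have "AE \<theta> in lborel. \<theta> \<notin> latitudes"
    proof eventually_elim
      case (elim \<theta>)
      have "cos \<theta> ^ n > 0" if "\<theta> \<in> latitudes" using that by (simp add: cos_gt_zero_pi)
      then show ?case using elim by (auto simp: ennreal_eq_0_iff not_le)
    qed
    then have "emeasure lborel latitudes = 0"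
      by (subst (asm) AE_iff_measurable[of "latitudes"]) auto
    then show False by simp
  qed
  ultimately show ?thesis using that by (cases ?Z) (auto simp: less_le)
qed

lemma emeasure_sphere_volume_0: "emeasure (sphere_volume 0) (topspace (nsphere 0)) = 2"
  using nn_integral_sphere_volume_0[of "\<lambda>_. 1"] by (simp flip: space_sphere_volume)

lemma emeasure_sphere_volume_Suc:
  "emeasure (sphere_volume (Suc n)) (topspace (nsphere (Suc n))) =
    (\<integral>\<^sup>+\<theta>\<in>latitudes. ennreal (cos \<theta> ^ n) \<partial>lborel) * emeasure (sphere_volume n) (topspace (nsphere n))"
proof -
  let ?V = "emeasure (sphere_volume n) (topspace (nsphere n))"
  have "emeasure (sphere_volume (Suc n)) (topspace (nsphere (Suc n)))
    = (\<integral>\<^sup>+\<theta>\<in>latitudes. ennreal (cos \<theta> ^ n) * ?V \<partial>lborel)"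
    using nn_integral_sphere_volume_Suc[of "\<lambda>_. 1" n] by (simp flip: space_sphere_volume)
  also have "\<dots> = (\<integral>\<^sup>+\<theta>. ennreal (cos \<theta> ^ n) * indicator latitudes \<theta> * ?V \<partial>lborel)"
    by (intro nn_integral_cong) (simp add: mult_ac)
  also have "\<dots> = (\<integral>\<^sup>+\<theta>\<in>latitudes. ennreal (cos \<theta> ^ n) \<partial>lborel) * ?V"
    by (rule nn_integral_multc) measurable
  finally show ?thesis .
qed

lemma emeasure_sphere_volume:
  obtains V where "0 < V" "emeasure (sphere_volume n) (topspace (nsphere n)) = ennreal V"
proof -
  have "\<exists>V>0. emeasure (sphere_volume n) (topspace (nsphere n)) = ennreal V"
  proof (induction n)
    case 0
    show ?case by (intro exI[of _ 2]) (simp add: emeasure_sphere_volume_0)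
  next
    case (Suc n)
    then obtain V where V: "0 < V" "emeasure (sphere_volume n) (topspace (nsphere n)) = ennreal V"
      by blast
    obtain Z where Z: "0 < Z" "(\<integral>\<^sup>+\<theta>\<in>latitudes. ennreal (cos \<theta> ^ n) \<partial>lborel) = ennreal Z"
      by (rule nn_integral_cos_power)
    show ?case
      using V Z by (intro exI[of _ "Z * V"]) (simp add: emeasure_sphere_volume_Suc ennreal_mult)
  qed
  then show ?thesis using that by blast
qed

lemma nn_integral_sphere_volume_permute:
  assumes f: "f permutes {..<n}" and G[measurable]: "G \<in> borel_measurable borel"
  shows "(\<integral>\<^sup>+x. G (\<lambda>i. x (f i)) \<partial>sphere_volume n) = (\<integral>\<^sup>+x. G x \<partial>sphere_volume n)"
proof -
  let ?f = "\<lambda>u::nat \<Rightarrow> real. \<lambda>i\<in>{..<n}. u (f i)"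
  have f_in: "f i < n \<longleftrightarrow> i < n" for i using permutes_in_image[OF f] by simp
  have f_fix: "f i = i" if "\<not> i < n" for i using permutes_not_in[OF f] that by simp
  have sq: "sqnorm n (?f u) = sqnorm n u" for u
    using sum.permute[OF f, of "\<lambda>i. (u i)\<^sup>2"] by (simp add: sqnorm_def comp_def)
  have param: "hemisphere_param n s (?f u) = (\<lambda>i. hemisphere_param n s u (f i))" for s u
  proof
    fix i
    show "hemisphere_param n s (?f u) i = hemisphere_param n s u (f i)"
      using f_in[of i] f_fix[of i] unfolding hemisphere_param_def sqnorm_def[symmetric] sq by auto
  qed
  have weight: "hemisphere_weight n (?f u) = hemisphere_weight n u" for u
    by (simp add: hemisphere_weight_def sq indicator_def)
  have f_meas[measurable]: "?f \<in> coord_lborel {..<n} \<rightarrow>\<^sub>M coord_lborel {..<n}"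
    using f_in by (intro measurable_restrict measurable_component_singleton) simp
  have G_f: "(\<lambda>x. G (\<lambda>i. x (f i))) \<in> borel_measurable borel"
    by (intro measurable_compose[OF _ G] measurable_coordinatewise_then_product
      measurable_product_coordinates)
  have "(\<integral>\<^sup>+u. G (hemisphere_param n s u) * hemisphere_weight n u \<partial>coord_lborel {..<n})
    = (\<integral>\<^sup>+u. G (\<lambda>i. hemisphere_param n s u (f i)) * hemisphere_weight n u \<partial>coord_lborel {..<n})" for s
    using nn_integral_distr[OF f_meas, of "\<lambda>u. G (hemisphere_param n s u) * hemisphere_weight n u"]
    by (simp add: distr_PiM_permute[OF _ f sigma_finite_lborel] param weight)
  then show ?thesis by (simp add: nn_integral_sphere_volume G_f)
qed

section \<open>Zonal integrals\<close>

lemma nn_integral_periodic_shift: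
  fixes k :: "real \<Rightarrow> ennreal"
  assumes [measurable]: "k \<in> borel_measurable borel" and "periodic_fun_simple k T" and T: "0 < T"
  shows "(\<integral>\<^sup>+x\<in>{a..<a + T}. k (x - d) \<partial>lborel) = (\<integral>\<^sup>+x\<in>{a..<a + T}. k x \<partial>lborel)"
proof -
  interpret periodic_fun_simple k T by fact
  define e where "e = d - of_int \<lfloor>d / T\<rfloor> * T"
  have e: "0 \<le> e" "e \<le> T"
    using floor_divide_lower[OF T, of d] floor_divide_upper[OF T, of d]
    by (simp_all add: e_def distrib_right)
  have "k (x - d) = k (x - e)" for x
    using minus_of_int[of "x - e" "\<lfloor>d / T\<rfloor>"] by (simp add: e_def)
  then have "(\<integral>\<^sup>+x\<in>{a..<a + T}. k (x - d) \<partial>lborel) = (\<integral>\<^sup>+x\<in>{a..<a + T}. k (x - e) \<partial>lborel)" by simp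
  also have "\<dots> = (\<integral>\<^sup>+x. k x * indicator {a..<a + T} (x + e) \<partial>lborel)"
    by (subst nn_integral_real_affine[of _ 1 e]) (auto simp: add.commute)
  also have "\<dots> = (\<integral>\<^sup>+x. k x * indicator {a - e..<a} x + k x * indicator {a..<a + T - e} x \<partial>lborel)"
    using e by (intro nn_integral_cong) (auto split: split_indicator)
  also have "\<dots> = (\<integral>\<^sup>+x\<in>{a - e..<a}. k x \<partial>lborel) + (\<integral>\<^sup>+x\<in>{a..<a + T - e}. k x \<partial>lborel)"
    by (rule nn_integral_add) auto
  also have "(\<integral>\<^sup>+x\<in>{a - e..<a}. k x \<partial>lborel)
      = (\<integral>\<^sup>+x. k (x + T) * indicator {a + T - e..<a + T} (x + T) \<partial>lborel)"
    by (intro nn_integral_cong) (auto simp: plus_period split: split_indicator)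
  also have "\<dots> = (\<integral>\<^sup>+x\<in>{a + T - e..<a + T}. k x \<partial>lborel)"
    by (subst (2) nn_integral_real_affine[of _ 1 T]) (auto simp: add.commute)
  also have "\<dots> + (\<integral>\<^sup>+x\<in>{a..<a + T - e}. k x \<partial>lborel)
    = (\<integral>\<^sup>+x. k x * indicator {a + T - e..<a + T} x + k x * indicator {a..<a + T - e} x \<partial>lborel)"
    by (rule nn_integral_add[symmetric]) auto
  also have "\<dots> = (\<integral>\<^sup>+x\<in>{a..<a + T}. k x \<partial>lborel)"
    using e by (intro nn_integral_cong) (auto split: split_indicator)
  finally show ?thesis .
qed

lemma measurable_inner_prod [measurable]: "(\<lambda>x. inner_prod k x q) \<in> borel_measurable borel"
proof -
  note measurable_product_coordinates [measurable]
  show ?thesis unfolding inner_prod_def by measurable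
qed

definition zonal_integral :: "nat \<Rightarrow> (real \<Rightarrow> ennreal) \<Rightarrow> (nat \<Rightarrow> real) \<Rightarrow> ennreal" where
  "zonal_integral n g p = (\<integral>\<^sup>+x. g (inner_prod (Suc n) x p) \<partial>sphere_volume n)"

lemma zonal_integral_0:
  assumes "g \<in> borel_measurable borel" and p: "p \<in> topspace (nsphere 0)"
  shows "zonal_integral 0 g p = g (-1) + g 1"
proof -
  have "p 0 = 1 \<or> p 0 = -1"
    using p by (simp add: in_nsphere_iff sqnorm_def power2_eq_1_iff)
  then show ?thesis
    using assms(1)
    by (auto simp: zonal_integral_def nn_integral_sphere_volume_0 inner_prod_def pole_def add.commute)
qed

lemma zonal_integral_slice:
  assumes [measurable]: "g \<in> borel_measurable borel"
  shows "zonal_integral (Suc n) g (slice n c s p) =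
    (\<integral>\<^sup>+\<theta>\<in>latitudes. ennreal (cos \<theta> ^ n) * zonal_integral n (\<lambda>a. g (cos \<theta> * c * a + sin \<theta> * s)) p
      \<partial>lborel)"
  unfolding zonal_integral_def by (subst nn_integral_sphere_volume_Suc) (simp_all add: inner_prod_slice)

lemma zonal_integral_circle:
  assumes g[measurable]: "g \<in> borel_measurable borel" and "p \<in> topspace (nsphere (Suc 0))"
  shows "zonal_integral (Suc 0) g p = (\<integral>\<^sup>+\<theta>\<in>{- (pi/2)..<- (pi/2) + pi}. g (- cos \<theta>) + g (cos \<theta>) \<partial>lborel)"
proof -
  obtain \<phi> q where q: "q \<in> topspace (nsphere 0)" and p: "p = at_latitude 0 \<phi> q"
    using nsphere_Suc_slice[OF assms(2)] .
  define k where "k \<theta> = g (- cos \<theta>) + g (cos \<theta>)" for \<theta>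
  have [measurable]: "k \<in> borel_measurable borel" unfolding k_def by measurable
  have "zonal_integral (Suc 0) g p = (\<integral>\<^sup>+\<theta>\<in>latitudes. g (- cos (\<theta> + \<phi>)) + g (cos (\<theta> - \<phi>)) \<partial>lborel)"
    unfolding p zonal_integral_slice[OF g]
    by (intro nn_integral_cong) (simp add: zonal_integral_0[OF _ q] cos_add cos_diff)
  also have "\<dots> = (\<integral>\<^sup>+\<theta>\<in>latitudes. g (- cos (\<theta> + \<phi>)) \<partial>lborel) + (\<integral>\<^sup>+\<theta>\<in>latitudes. g (cos (\<theta> - \<phi>)) \<partial>lborel)"
    by (simp add: nn_integral_add distrib_right)
  also have "(\<integral>\<^sup>+\<theta>\<in>latitudes. g (- cos (\<theta> + \<phi>)) \<partial>lborel) = (\<integral>\<^sup>+\<theta>\<in>latitudes. g (- cos (\<theta> - \<phi>)) \<partial>lborel)"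
  proof -
    have "cos (\<phi> - \<theta>) = cos (\<theta> - \<phi>)" for \<theta> using cos_minus[of "\<theta> - \<phi>"] by simp
    then show ?thesis
      by (subst nn_integral_real_affine[of _ "-1" 0])
         (auto intro!: nn_integral_cong simp: add.commute split: split_indicator)
  qed
  also have "\<dots> + (\<integral>\<^sup>+\<theta>\<in>latitudes. g (cos (\<theta> - \<phi>)) \<partial>lborel) = (\<integral>\<^sup>+\<theta>\<in>latitudes. k (\<theta> - \<phi>) \<partial>lborel)"
    by (simp add: k_def nn_integral_add distrib_right)
  also have "\<dots> = (\<integral>\<^sup>+\<theta>\<in>{- (pi/2)..<- (pi/2) + pi}. k (\<theta> - \<phi>) \<partial>lborel)"
    by (rule nn_integral_cong_AE, rule AE_mp[OF AE_lborel_singleton[of "- (pi/2)"]])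
       (auto split: split_indicator)
  also have "\<dots> = (\<integral>\<^sup>+\<theta>\<in>{- (pi/2)..<- (pi/2) + pi}. k \<theta> \<partial>lborel)"
    by (rule nn_integral_periodic_shift) (auto simp: periodic_fun_simple_def k_def add.commute)
  finally show ?thesis by (simp add: k_def)
qed

lemma zonal_integral_permute:
  assumes [measurable]: "g \<in> borel_measurable borel" and f: "f permutes {..<n}"
  shows "zonal_integral n g (\<lambda>i. p (f i)) = zonal_integral n g p"
proof -
  have f': "f permutes {..<Suc n}" using f by (rule permutes_subset) auto
  have "inner_prod (Suc n) (\<lambda>i. x (f i)) (\<lambda>i. p (f i)) = inner_prod (Suc n) x p" for x
    using sum.permute[OF f', of "\<lambda>i. x i * p i"] by (simp add: inner_prod_def comp_def)
  then have "zonal_integral n g p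
      = (\<integral>\<^sup>+x. g (inner_prod (Suc n) (\<lambda>i. x (f i)) (\<lambda>i. p (f i))) \<partial>sphere_volume n)"
    by (simp add: zonal_integral_def)
  also have "\<dots> = zonal_integral n g (\<lambda>i. p (f i))"
    unfolding zonal_integral_def by (rule nn_integral_sphere_volume_permute[OF f]) measurable
  finally show ?thesis by simp
qed

text \<open>Induction on the dimension. The induction hypothesis moves the pole within a parallel sphere;
  after exchanging two coordinates of a pole chosen there, all poles lie on one parallel sphere.\<close>

lemma zonal_integral_pole:
  assumes "g \<in> borel_measurable borel" "p \<in> topspace (nsphere n)"
  shows "zonal_integral n g p = zonal_integral n g (pole n)"
  using assms
proof (induction n arbitrary: g p)
  case 0
  then show ?case by (simp add: zonal_integral_0 pole_in_nsphere)
next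
  case (Suc n)
  show ?case
  proof (cases "n = 0")
    case True
    then show ?thesis using Suc.prems by (simp add: zonal_integral_circle pole_in_nsphere)
  next
    case False
    note [measurable] = Suc.prems(1)
    have parallel:
      "zonal_integral (Suc n) g (slice n c s q) = zonal_integral (Suc n) g (slice n c s (pole n))"
      if "q \<in> topspace (nsphere n)" for c s q
      unfolding zonal_integral_slice[OF Suc.prems(1)] using Suc.IH[OF _ that] by simp
    obtain t q where q: "q \<in> topspace (nsphere n)" and p: "p = at_latitude n t q"
      using nsphere_Suc_slice[OF Suc.prems(2)] .
    define f where "f = Transposition.transpose 0 n"
    have f: "f permutes {..<Suc n}" unfolding f_def by (rule permutes_swap_id) auto
    define q' where "q' = (\<lambda>i. if i = 0 then sin t else if i = n then cos t else 0)"
    have "sqnorm n q' = (\<Sum>i<n. if i = 0 then (sin t)\<^sup>2 else 0)"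
      unfolding sqnorm_def by (intro sum.cong) (auto simp: q'_def)
    then have "q' \<in> topspace (nsphere n)"
      using False by (simp add: in_nsphere_iff sqnorm_Suc) (simp add: q'_def)
    moreover have "(\<lambda>i. at_latitude n t (pole n) (f i)) = slice n 1 0 q'"
      using False by (auto simp: fun_eq_iff f_def Transposition.transpose_def slice_def pole_def q'_def)
    ultimately have "zonal_integral (Suc n) g (at_latitude n t (pole n))
        = zonal_integral (Suc n) g (slice n 1 0 (pole n))"
      using zonal_integral_permute[OF Suc.prems(1) f, of "at_latitude n t (pole n)"] parallel by simp
    moreover have "slice n 1 0 (pole n) = pole (Suc n)"
      by (auto simp: fun_eq_iff slice_def pole_def)
    ultimately show ?thesis using parallel[OF q] p by simp
  qed
qed

section \<open>The Euclidean metric on the sphere\<close>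

lemma edist_eq_sqnorm: "edist k x y = sqrt (sqnorm k (\<lambda>i. x i - y i))"
  by (simp add: edist_def sqnorm_def L2_set_def)

lemma edist_nonneg: "0 \<le> edist k x y"
  by (simp add: edist_eq_sqnorm sqnorm_nonneg)

lemma edist_sq: "(edist k x y)\<^sup>2 = sqnorm k x + sqnorm k y - 2 * inner_prod k x y"
proof -
  have "(edist k x y)\<^sup>2 = sqnorm k (\<lambda>i. x i - y i)" by (simp add: edist_eq_sqnorm sqnorm_nonneg)
  also have "\<dots> = sqnorm k x + sqnorm k y - 2 * inner_prod k x y"
    by (simp add: sqnorm_def inner_prod_def power2_diff sum.distrib sum_subtractf sum_distrib_left
      mult.assoc)
  finally show ?thesis .
qed

lemma edist_triangle: "edist k x z \<le> edist k x y + edist k y z"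
proof -
  have "L2_set (\<lambda>i. (x i - y i) + (y i - z i)) {..<k} \<le> edist k x y + edist k y z"
    unfolding edist_def by (rule L2_set_triangle_ineq)
  then show ?thesis by (simp add: edist_def)
qed

lemma edist_commute: "edist k x y = edist k y x"
  unfolding edist_def L2_set_def by (simp add: power2_commute)

lemma elipschitz_on_nonneg: "elipschitz_on k L A f \<Longrightarrow> 0 \<le> L"
  by (simp add: elipschitz_on_def)

lemma elipschitz_onD: "\<lbrakk>elipschitz_on k L A f; x \<in> A; y \<in> A\<rbrakk> \<Longrightarrow> dist (f x) (f y) \<le> L * edist k x y"
  by (simp add: elipschitz_on_def)

lemma measurable_edist [measurable]: "(\<lambda>x. edist k x q) \<in> borel_measurable borel"
proof -
  note measurable_product_coordinates [measurable]
  show ?thesis unfolding edist_eq_sqnorm sqnorm_def by measurable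
qed

lemma edist_nsphere:
  assumes "p \<in> topspace (nsphere n)" "q \<in> topspace (nsphere n)"
  shows "edist (Suc n) p q = sqrt (2 - 2 * inner_prod (Suc n) p q)"
  using assms edist_sq[of "Suc n" p q] edist_nonneg[of "Suc n" p q]
  by (intro real_sqrt_unique[symmetric]) (simp_all add: in_nsphere_iff)

lemma edist_sq_direction:
  fixes n :: nat
  defines "r \<equiv> \<lambda>x. sqrt (sqnorm (Suc n) x)"
  shows "(edist (Suc n) x y)\<^sup>2
    = (r x - r y)\<^sup>2 + r x * r y * (edist (Suc n) (direction n x) (direction n y))\<^sup>2"
proof -
  have "inner_prod (Suc n) x y = r x * r y * inner_prod (Suc n) (direction n x) (direction n y)"
    unfolding inner_prod_def sum_distrib_left
  proof (rule sum.cong[OF refl])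
    fix i assume "i \<in> {..<Suc n}"
    then have "x i = r x * direction n x i" "y i = r y * direction n y i"
      by (simp_all add: r_def sqrt_sqnorm_times_direction less_Suc_eq_le)
    then show "x i * y i = r x * r y * (direction n x i * direction n y i)"
      by (metis mult.assoc mult.commute)
  qed
  moreover have "(r z)\<^sup>2 = sqnorm (Suc n) z" "sqnorm (Suc n) (direction n z) = 1" for z
    using direction_in_nsphere[of n z] by (simp_all add: r_def sqnorm_nonneg in_nsphere_iff)
  ultimately show ?thesis by (simp add: edist_sq power2_diff algebra_simps)
qed

lemma edist_ge_direction:
  fixes n :: nat
  defines "r \<equiv> \<lambda>x. sqrt (sqnorm (Suc n) x)"
  assumes xy: "sqnorm (Suc n) x \<le> sqnorm (Suc n) y"
  shows "sqrt ((r x * edist (Suc n) (direction n x) (direction n y))\<^sup>2 + (r y - r x)\<^sup>2)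
      \<le> edist (Suc n) x y"
proof (rule real_le_lsqrt)
  let ?d = "edist (Suc n) (direction n x) (direction n y)"
  have "0 \<le> r x" "r x \<le> r y" using xy by (simp_all add: r_def sqnorm_nonneg)
  then have "r x * r x * ?d\<^sup>2 \<le> r x * r y * ?d\<^sup>2" by (intro mult_right_mono mult_left_mono) auto
  moreover have "(edist (Suc n) x y)\<^sup>2 = (r x - r y)\<^sup>2 + r x * r y * ?d\<^sup>2"
    unfolding r_def by (rule edist_sq_direction)
  ultimately show "(r x * ?d)\<^sup>2 + (r y - r x)\<^sup>2 \<le> (edist (Suc n) x y)\<^sup>2"
    by (simp add: power_mult_distrib power2_eq_square[of "r x"] power2_commute[of "r y" "r x"])
qed (simp_all add: edist_nonneg)

lemma uminus_in_nsphere: "q \<in> topspace (nsphere n) \<Longrightarrow> (\<lambda>i. - q i) \<in> topspace (nsphere n)"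
  by (simp add: in_nsphere_iff sqnorm_def)

lemma edist_antipode_le:
  assumes "p \<in> topspace (nsphere n)" "q \<in> topspace (nsphere n)"
  shows "edist (Suc n) p q + edist (Suc n) p (\<lambda>i. - q i) \<le> 2 * sqrt 2"
proof -
  define a where "a = edist (Suc n) p q"
  define b where "b = edist (Suc n) p (\<lambda>i. - q i)"
  have "inner_prod (Suc n) p (\<lambda>i. - q i) = - inner_prod (Suc n) p q"
    by (simp add: inner_prod_def sum_negf)
  then have "a\<^sup>2 + b\<^sup>2 = 4"
    using assms uminus_in_nsphere[OF assms(2)] by (simp add: a_def b_def edist_sq in_nsphere_iff)
  then have "(a + b)\<^sup>2 \<le> (2 * sqrt 2)\<^sup>2"
    using zero_le_power2[of "a - b"] by (simp add: power2_sum power2_diff)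
  then show ?thesis unfolding a_def[symmetric] b_def[symmetric] by (rule power2_le_imp_le) simp
qed

lemma edist_nsphere_le_2:
  assumes "p \<in> topspace (nsphere n)" "q \<in> topspace (nsphere n)"
  shows "edist (Suc n) p q \<le> 2"
proof -
  have "edist (Suc n) p (\<lambda>_. 0) = 1" "edist (Suc n) q (\<lambda>_. 0) = 1"
    using assms by (simp_all add: edist_eq_sqnorm in_nsphere_iff)
  then show ?thesis using edist_triangle[of "Suc n" p q "\<lambda>_. 0"] by (simp add: edist_commute)
qed

lemma edist_slice_le: "\<bar>c\<bar> \<le> 1 \<Longrightarrow> edist (Suc (Suc n)) (slice n c s x) (slice n c s y) \<le> edist (Suc n) x y"
proof -
  assume c: "\<bar>c\<bar> \<le> 1"
  have "(\<lambda>i. slice n c s x i - slice n c s y i) = slice n c 0 (\<lambda>i. x i - y i)"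
    by (auto simp: slice_def fun_eq_iff right_diff_distrib)
  then have "edist (Suc (Suc n)) (slice n c s x) (slice n c s y) = \<bar>c\<bar> * edist (Suc n) x y"
    by (simp add: edist_eq_sqnorm sqnorm_slice real_sqrt_mult)
  also have "\<dots> \<le> 1 * edist (Suc n) x y" using c by (intro mult_right_mono edist_nonneg)
  finally show ?thesis by simp
qed

lemma edist_at_latitude_le:
  assumes "y \<in> topspace (nsphere n)"
  shows "edist (Suc (Suc n)) (at_latitude n a y) (at_latitude n b y) \<le> \<bar>a - b\<bar>"
proof -
  have half: "2 * ((a - b) / 2) = a - b" by simp
  have "cos (a - b) = 1 - 2 * (sin ((a - b) / 2))\<^sup>2"
    by (rule cos_double_sin[of "(a - b) / 2", unfolded half])
  moreover have "inner_prod (Suc n) y y = 1"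
    using assms by (simp add: in_nsphere_iff sqnorm_def inner_prod_def power2_eq_square)
  ultimately have
    "(edist (Suc (Suc n)) (at_latitude n a y) (at_latitude n b y))\<^sup>2 = (2 * sin ((a - b) / 2))\<^sup>2"
    using assms
    by (simp add: edist_sq inner_prod_slice sqnorm_slice in_nsphere_iff power_mult_distrib flip: cos_diff)
  also have "\<dots> \<le> \<bar>a - b\<bar>\<^sup>2"
    using abs_sin_x_le_abs_x[of "(a - b) / 2"] by (intro power2_mono) (simp add: abs_mult)
  finally show ?thesis by (rule power2_le_imp_le) simp
qed

section \<open>Contracting means on the sphere\<close>

definition sphere_distribution :: "nat \<Rightarrow> (nat \<Rightarrow> real) measure" where
  "sphere_distribution n = uniform_measure (sphere_volume n) (topspace (nsphere n))"

lemma space_sphere_distribution: "space (sphere_distribution n) = topspace (nsphere n)"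
  by (simp add: sphere_distribution_def space_sphere_volume)

lemma measurable_sphere_distribution: "f \<in> borel \<rightarrow>\<^sub>M N \<Longrightarrow> f \<in> sphere_distribution n \<rightarrow>\<^sub>M N"
  unfolding sphere_distribution_def by (simp add: measurable_sphere_volume cong: measurable_cong_sets)

lemma prob_space_sphere_distribution: "prob_space (sphere_distribution n)"
proof -
  obtain V where "0 < V" "emeasure (sphere_volume n) (topspace (nsphere n)) = ennreal V"
    by (rule emeasure_sphere_volume)
  then show ?thesis
    unfolding sphere_distribution_def by (intro prob_space_uniform_measure) auto
qed

lemma nn_integral_sphere_distribution:
  assumes "G \<in> borel_measurable borel"
  shows "(\<integral>\<^sup>+x. G x \<partial>sphere_distribution n) =
    (\<integral>\<^sup>+x. G x \<partial>sphere_volume n) / emeasure (sphere_volume n) (topspace (nsphere n))"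
proof -
  have "(\<integral>\<^sup>+x. G x * indicator (topspace (nsphere n)) x \<partial>sphere_volume n) = (\<integral>\<^sup>+x. G x \<partial>sphere_volume n)"
    by (rule nn_integral_cong) (simp add: space_sphere_volume)
  then show ?thesis
    unfolding sphere_distribution_def
    using assms sets.top[of "sphere_volume n"]
    by (subst nn_integral_uniform_measure) (auto simp: measurable_sphere_volume space_sphere_volume)
qed

definition latitude_distribution :: "nat \<Rightarrow> real measure" where
  "latitude_distribution n = uniform_measure (density lborel (\<lambda>\<theta>. ennreal (cos \<theta> ^ n))) latitudes"

lemma emeasure_density_cos_power:
  "emeasure (density lborel (\<lambda>\<theta>. ennreal (cos \<theta> ^ n))) latitudes
    = (\<integral>\<^sup>+\<theta>\<in>latitudes. ennreal (cos \<theta> ^ n) \<partial>lborel)"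
  by (simp add: emeasure_density)

lemma real_distribution_latitude_distribution: "real_distribution (latitude_distribution n)"
proof -
  obtain Z where "0 < Z" "(\<integral>\<^sup>+\<theta>\<in>latitudes. ennreal (cos \<theta> ^ n) \<partial>lborel) = ennreal Z"
    by (rule nn_integral_cos_power)
  then interpret prob_space "latitude_distribution n"
    unfolding latitude_distribution_def
    by (intro prob_space_uniform_measure) (auto simp: emeasure_density_cos_power)
  show ?thesis by standard (simp_all add: latitude_distribution_def)
qed

lemma nn_integral_latitude_distribution:
  assumes "f \<in> borel_measurable borel"
  shows "(\<integral>\<^sup>+\<theta>. f \<theta> \<partial>latitude_distribution n) =
    (\<integral>\<^sup>+\<theta>\<in>latitudes. ennreal (cos \<theta> ^ n) * f \<theta> \<partial>lborel) / (\<integral>\<^sup>+\<theta>\<in>latitudes. ennreal (cos \<theta> ^ n) \<partial>lborel)"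
  using assms unfolding latitude_distribution_def
  by (subst nn_integral_uniform_measure)
    (simp_all add: nn_integral_density emeasure_density_cos_power mult.assoc)

lemma measurable_nn_integral_at_latitude:
  assumes "G \<in> borel_measurable borel"
  shows "(\<lambda>\<theta>. \<integral>\<^sup>+y. G (at_latitude n \<theta> y) \<partial>sphere_distribution n) \<in> borel_measurable borel"
proof -
  have "(\<lambda>y. G (at_latitude n \<theta> y)) \<in> borel_measurable borel" for \<theta>
    using assms by measurable
  then show ?thesis
    using measurable_nn_integral_slice[OF assms, of cos sin n]
    by (simp add: nn_integral_sphere_distribution)
qed

lemma nn_integral_sphere_distribution_Suc:
  assumes G[measurable]: "G \<in> borel_measurable borel"
  shows "(\<integral>\<^sup>+x. G x \<partial>sphere_distribution (Suc n)) =
    (\<integral>\<^sup>+\<theta>. \<integral>\<^sup>+y. G (at_latitude n \<theta> y) \<partial>sphere_distribution n \<partial>latitude_distribution n)"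
proof -
  obtain V where V: "0 < V" "emeasure (sphere_volume n) (topspace (nsphere n)) = ennreal V"
    by (rule emeasure_sphere_volume)
  obtain Z where Z: "0 < Z" "(\<integral>\<^sup>+\<theta>\<in>latitudes. ennreal (cos \<theta> ^ n) \<partial>lborel) = ennreal Z"
    by (rule nn_integral_cos_power)
  define J where "J \<theta> = (\<integral>\<^sup>+y. G (at_latitude n \<theta> y) \<partial>sphere_volume n)" for \<theta>
  have J[measurable]: "J \<in> borel_measurable borel"
    unfolding J_def by (rule measurable_nn_integral_slice) measurable
  have "(\<integral>\<^sup>+y. G (at_latitude n \<theta> y) \<partial>sphere_distribution n) = J \<theta> / ennreal V" for \<theta>
    unfolding J_def V(2)[symmetric] by (rule nn_integral_sphere_distribution) measurable
  then have "(\<integral>\<^sup>+\<theta>. \<integral>\<^sup>+y. G (at_latitude n \<theta> y) \<partial>sphere_distribution n \<partial>latitude_distribution n)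
    = (\<integral>\<^sup>+\<theta>. (ennreal (cos \<theta> ^ n) * J \<theta> * indicator latitudes \<theta>) / ennreal V \<partial>lborel) / ennreal Z"
    by (simp add: nn_integral_latitude_distribution Z(2) divide_ennreal_def mult_ac)
  also have "\<dots> = (\<integral>\<^sup>+\<theta>\<in>latitudes. ennreal (cos \<theta> ^ n) * J \<theta> \<partial>lborel) / (ennreal Z * ennreal V)"
    by (subst nn_integral_divide) (auto simp: divide_ennreal_def ennreal_inverse_mult mult_ac)
  also have "\<dots> = (\<integral>\<^sup>+x. G x \<partial>sphere_distribution (Suc n))"
    by (simp add: nn_integral_sphere_distribution emeasure_sphere_volume_Suc V(2) Z(2)
      nn_integral_sphere_volume_Suc J_def)
  finally show ?thesis by simp
qed

lemma nsphere_in_borel: "topspace (nsphere n) \<in> sets borel"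
proof -
  note measurable_product_coordinates [measurable]
  have "{x \<in> space borel. (\<forall>i. n < i \<longrightarrow> x i = 0) \<and> sqnorm (Suc n) x = (1::real)}
      \<in> sets (borel :: (nat \<Rightarrow> real) measure)"
    unfolding sqnorm_def by measurable
  moreover have "topspace (nsphere n) = {x \<in> space borel. (\<forall>i. n < i \<longrightarrow> x i = 0) \<and> sqnorm (Suc n) x = 1}"
    by (auto simp: in_nsphere_iff)
  ultimately show ?thesis by (simp only:)
qed

lemma contracting_mean_sphereI:
  assumes "\<And>h. h \<in> H \<Longrightarrow> \<beta> h \<in> Y" and "\<And>y. y \<in> Y \<Longrightarrow> \<beta> (\<lambda>_. y) = y"
    and le: "\<And>h h' \<psi>. \<lbrakk>h \<in> H; h' \<in> H; \<psi> \<in> borel_measurable borel;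
        \<And>x. x \<in> topspace (nsphere n) \<Longrightarrow> ennreal (dist (h x) (h' x)) \<le> \<psi> x\<rbrakk> \<Longrightarrow>
      ennreal (dist (\<beta> h) (\<beta> h')) \<le> (\<integral>\<^sup>+x. \<psi> x \<partial>sphere_distribution n)"
  shows "contracting_mean (sphere_distribution n) Y H \<beta>"
  unfolding contracting_mean_def space_sphere_distribution
proof (intro conjI ballI impI)
  fix h h' \<psi>
  assume h: "h \<in> H" "h' \<in> H" and \<psi>: "\<psi> \<in> borel_measurable (sphere_distribution n)"
    and bound: "\<forall>x\<in>topspace (nsphere n). ennreal (dist (h x) (h' x)) \<le> \<psi> x"
  let ?\<psi> = "\<lambda>x. \<psi> x * indicator (topspace (nsphere n)) x"
  have "\<psi> \<in> borel_measurable (restrict_space borel (topspace (nsphere n)))"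
    using \<psi> by (simp add: sphere_distribution_def sets_sphere_volume cong: measurable_cong_sets)
  then have "?\<psi> \<in> borel_measurable borel"
    using nsphere_in_borel by (subst (asm) borel_measurable_restrict_space_iff_ennreal) auto
  then have "ennreal (dist (\<beta> h) (\<beta> h')) \<le> (\<integral>\<^sup>+x. ?\<psi> x \<partial>sphere_distribution n)"
    using bound by (intro le h) auto
  also have "\<dots> = (\<integral>\<^sup>+x. \<psi> x \<partial>sphere_distribution n)"
    by (rule nn_integral_cong) (simp add: space_sphere_distribution)
  finally show "ennreal (dist (\<beta> h) (\<beta> h')) \<le> (\<integral>\<^sup>+x. \<psi> x \<partial>sphere_distribution n)" .
qed (use assms in auto)

definition sphere_Lipschitz :: "nat \<Rightarrow> 'a::metric_space set \<Rightarrow> ((nat \<Rightarrow> real) \<Rightarrow> 'a) set" where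
  "sphere_Lipschitz n Y
      = {h \<in> topspace (nsphere n) \<rightarrow> Y. \<exists>L. elipschitz_on (Suc n) L (topspace (nsphere n)) h}"

lemma at_latitude_in_nsphere: "y \<in> topspace (nsphere n) \<Longrightarrow> at_latitude n \<theta> y \<in> topspace (nsphere (Suc n))"
  by (rule slice_in_nsphere) simp_all

lemma elipschitz_on_at_latitude:
  assumes h: "elipschitz_on (Suc (Suc n)) L (topspace (nsphere (Suc n))) h"
  shows "elipschitz_on (Suc n) L (topspace (nsphere n)) (\<lambda>y. h (at_latitude n \<theta> y))"
  unfolding elipschitz_on_def
proof (intro conjI ballI)
  show L: "0 \<le> L" using h by (rule elipschitz_on_nonneg)
  fix x y assume "x \<in> topspace (nsphere n)" "y \<in> topspace (nsphere n)"
  then have "dist (h (at_latitude n \<theta> x)) (h (at_latitude n \<theta> y))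
    \<le> L * edist (Suc (Suc n)) (at_latitude n \<theta> x) (at_latitude n \<theta> y)"
    by (intro elipschitz_onD[OF h] at_latitude_in_nsphere)
  also have "\<dots> \<le> L * edist (Suc n) x y" using L by (intro mult_left_mono edist_slice_le) simp_all
  finally show "dist (h (at_latitude n \<theta> x)) (h (at_latitude n \<theta> y)) \<le> L * edist (Suc n) x y" .
qed

lemma sphere_Lipschitz_at_latitude:
  "h \<in> sphere_Lipschitz (Suc n) Y \<Longrightarrow> (\<lambda>y. h (at_latitude n \<theta> y)) \<in> sphere_Lipschitz n Y"
  using at_latitude_in_nsphere
  by (auto simp: sphere_Lipschitz_def Pi_iff intro!: elipschitz_on_at_latitude)

definition latitude_mean :: "nat \<Rightarrow> (((nat \<Rightarrow> real) \<Rightarrow> 'a) \<Rightarrow> 'a) \<Rightarrow> ((nat \<Rightarrow> real) \<Rightarrow> 'a) \<Rightarrow> real \<Rightarrow> 'a" where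
  "latitude_mean n \<beta> h \<theta> = \<beta> (\<lambda>y. h (at_latitude n \<theta> y))"

lemma dist_latitude_mean_le:
  assumes \<beta>: "contracting_mean (sphere_distribution n) Y (sphere_Lipschitz n Y) \<beta>"
    and h: "h \<in> sphere_Lipschitz (Suc n) Y"
      "elipschitz_on (Suc (Suc n)) L (topspace (nsphere (Suc n))) h"
    and e: "0 \<le> e"
      "\<And>y. y \<in> topspace (nsphere n) \<Longrightarrow> edist (Suc (Suc n)) (at_latitude n a y) (at_latitude n b y) \<le> e"
  shows "dist (latitude_mean n \<beta> h a) (latitude_mean n \<beta> h b) \<le> L * e"
  unfolding latitude_mean_def
proof (rule contracting_mean_uniform_dist_le[OF \<beta> prob_space_sphere_distribution])
  have L: "0 \<le> L" using h(2) by (rule elipschitz_on_nonneg)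
  then show "0 \<le> L * e" using e(1) by simp
  fix y assume "y \<in> space (sphere_distribution n)"
  then have y: "y \<in> topspace (nsphere n)" by (simp add: space_sphere_distribution)
  then have "dist (h (at_latitude n a y)) (h (at_latitude n b y))
    \<le> L * edist (Suc (Suc n)) (at_latitude n a y) (at_latitude n b y)"
    by (intro elipschitz_onD[OF h(2)] at_latitude_in_nsphere)
  also have "\<dots> \<le> L * e" using e(2)[OF y] L by (rule mult_left_mono)
  finally show "dist (h (at_latitude n a y)) (h (at_latitude n b y)) \<le> L * e" .
qed (intro sphere_Lipschitz_at_latitude h)+

lemma latitude_mean_in_bounded_continuous_maps:
  assumes \<beta>: "contracting_mean (sphere_distribution n) Y (sphere_Lipschitz n Y) \<beta>"
    and h: "h \<in> sphere_Lipschitz (Suc n) Y"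
  shows "latitude_mean n \<beta> h \<in> bounded_continuous_maps Y"
proof -
  obtain L where L: "elipschitz_on (Suc (Suc n)) L (topspace (nsphere (Suc n))) h"
    using h by (auto simp: sphere_Lipschitz_def)
  note dist_le = dist_latitude_mean_le[OF \<beta> h L]
  have "dist (latitude_mean n \<beta> h a) (latitude_mean n \<beta> h b) \<le> L * 2" for a b
    by (intro dist_le edist_nsphere_le_2 at_latitude_in_nsphere) simp
  then have "bounded (range (latitude_mean n \<beta> h))" unfolding bounded_def by blast
  moreover have "L-lipschitz_on UNIV (latitude_mean n \<beta> h)"
    using elipschitz_on_nonneg[OF L] dist_le edist_at_latitude_le
    by (intro lipschitz_onI) (auto simp: dist_real_def)
  then have "continuous_on UNIV (latitude_mean n \<beta> h)" by (rule lipschitz_on_continuous_on)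
  moreover have "latitude_mean n \<beta> h \<theta> \<in> Y" for \<theta>
    unfolding latitude_mean_def using h by (intro contracting_mean_in[OF \<beta>] sphere_Lipschitz_at_latitude)
  ultimately show ?thesis by (auto simp: bounded_continuous_maps_def)
qed

lemma contracting_mean_sphere_Suc:
  assumes \<beta>: "contracting_mean (sphere_distribution n) Y (sphere_Lipschitz n Y) \<beta>"
    and \<gamma>: "contracting_mean (latitude_distribution n) Y (bounded_continuous_maps Y) \<gamma>"
  shows "contracting_mean (sphere_distribution (Suc n)) Y (sphere_Lipschitz (Suc n) Y)
      (\<lambda>h. \<gamma> (latitude_mean n \<beta> h))"
proof (rule contracting_mean_sphereI)
  show "\<gamma> (latitude_mean n \<beta> h) \<in> Y" if "h \<in> sphere_Lipschitz (Suc n) Y" for h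
    using that by (intro contracting_mean_in[OF \<gamma>] latitude_mean_in_bounded_continuous_maps[OF \<beta>])
  show "\<gamma> (latitude_mean n \<beta> (\<lambda>_. y)) = y" if "y \<in> Y" for y
    using that
    by (simp add: latitude_mean_def[abs_def] contracting_mean_const[OF \<beta>] contracting_mean_const[OF \<gamma>])
next
  fix h h' \<psi>
  assume h: "h \<in> sphere_Lipschitz (Suc n) Y" "h' \<in> sphere_Lipschitz (Suc n) Y"
    and \<psi>[measurable]: "\<psi> \<in> borel_measurable borel"
    and bound: "\<And>x. x \<in> topspace (nsphere (Suc n)) \<Longrightarrow> ennreal (dist (h x) (h' x)) \<le> \<psi> x"
  interpret latitude: real_distribution "latitude_distribution n"
    by (rule real_distribution_latitude_distribution)
  have "ennreal (dist (latitude_mean n \<beta> h \<theta>) (latitude_mean n \<beta> h' \<theta>))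
    \<le> (\<integral>\<^sup>+y. \<psi> (at_latitude n \<theta> y) \<partial>sphere_distribution n)" for \<theta>
    unfolding latitude_mean_def
  proof (rule contracting_mean_dist_le[OF \<beta>])
    show "(\<lambda>y. \<psi> (at_latitude n \<theta> y)) \<in> borel_measurable (sphere_distribution n)"
      by (rule measurable_sphere_distribution) measurable
  qed (use h bound in \<open>auto simp: space_sphere_distribution
    intro: sphere_Lipschitz_at_latitude at_latitude_in_nsphere\<close>)
  then have "ennreal (dist (\<gamma> (latitude_mean n \<beta> h)) (\<gamma> (latitude_mean n \<beta> h')))
    \<le> (\<integral>\<^sup>+\<theta>. \<integral>\<^sup>+y. \<psi> (at_latitude n \<theta> y) \<partial>sphere_distribution n \<partial>latitude_distribution n)"
    using h measurable_nn_integral_at_latitude[OF \<psi>]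
    by (intro contracting_mean_dist_le[OF \<gamma>] latitude_mean_in_bounded_continuous_maps[OF \<beta>]) simp_all
  then show "ennreal (dist (\<gamma> (latitude_mean n \<beta> h)) (\<gamma> (latitude_mean n \<beta> h')))
      \<le> (\<integral>\<^sup>+x. \<psi> x \<partial>sphere_distribution (Suc n))"
    by (simp only: nn_integral_sphere_distribution_Suc[OF \<psi>])
qed

context complete_midpoint_space
begin

lemma contracting_mean_sphere_0:
  "contracting_mean (sphere_distribution 0) Y (sphere_Lipschitz 0 Y)
    (\<lambda>h. mid (h (\<lambda>i. - pole 0 i)) (h (pole 0)))"
proof (rule contracting_mean_sphereI)
  define e e' :: "nat \<Rightarrow> real" where "e = pole 0" and "e' = (\<lambda>i. - pole 0 i)"
  have poles: "e \<in> topspace (nsphere 0)" "e' \<in> topspace (nsphere 0)"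
    by (simp_all add: e_def e'_def pole_in_nsphere uminus_in_nsphere)
  then have hY: "h e' \<in> Y" "h e \<in> Y" if "h \<in> sphere_Lipschitz 0 Y" for h
    using that by (auto simp: sphere_Lipschitz_def)
  then show "mid (h (\<lambda>i. - pole 0 i)) (h (pole 0)) \<in> Y" if "h \<in> sphere_Lipschitz 0 Y" for h
    using that unfolding e_def e'_def by (intro mid_in)
  show "mid y y = y" if "y \<in> Y" for y using that by (rule mid_idem)
  fix h h' \<psi>
  assume h: "h \<in> sphere_Lipschitz 0 Y" "h' \<in> sphere_Lipschitz 0 Y" and \<psi>: "\<psi> \<in> borel_measurable borel"
    and bound: "\<And>x. x \<in> topspace (nsphere 0) \<Longrightarrow> ennreal (dist (h x) (h' x)) \<le> \<psi> x"
  have "ennreal (dist (mid (h e') (h e)) (mid (h' e') (h' e))) \<le> ennreal (1/2) * (\<psi> e' + \<psi> e)"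
    using ennreal_dist_mid_le[OF hY[OF h(1)] hY[OF h(2)]] poles
    by (elim order_trans) (intro mult_left_mono add_mono bound; simp)
  also have "\<dots> = (\<integral>\<^sup>+x. \<psi> x \<partial>sphere_distribution 0)"
    unfolding e_def e'_def using \<psi>
    by (simp add: nn_integral_sphere_distribution nn_integral_sphere_volume_0 emeasure_sphere_volume_0
        divide_ennreal_def mult.commute)
  finally show "ennreal (dist (mid (h (\<lambda>i. - pole 0 i)) (h (pole 0)))
      (mid (h' (\<lambda>i. - pole 0 i)) (h' (pole 0))))
    \<le> (\<integral>\<^sup>+x. \<psi> x \<partial>sphere_distribution 0)"
    by (simp only: e_def e'_def)
qed

lemma ex_contracting_mean_sphere:
  "\<exists>\<beta>. contracting_mean (sphere_distribution n) Y (sphere_Lipschitz n Y) \<beta>"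
proof (induction n)
  case 0
  show ?case using contracting_mean_sphere_0 by blast
next
  case (Suc n)
  then show ?case
    using contracting_mean_sphere_Suc
      ex_contracting_mean_real_distribution[OF real_distribution_latitude_distribution]
    by blast
qed

end

section \<open>The mean distance\<close>

lemma nn_integral_edist_sphere_distribution:
  assumes q: "q \<in> topspace (nsphere n)"
  shows "(\<integral>\<^sup>+x. ennreal (edist (Suc n) x q) \<partial>sphere_distribution n) = ennreal (mean_dist n q)"
proof -
  obtain V where V: "0 < V" "emeasure (sphere_volume n) (topspace (nsphere n)) = ennreal V"
    by (rule emeasure_sphere_volume)
  define A where "A = (\<integral>\<^sup>+x. ennreal (edist (Suc n) x q) \<partial>sphere_volume n)"
  have "A \<le> (\<integral>\<^sup>+x. ennreal 2 \<partial>sphere_volume n)"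
    unfolding A_def using q
    by (intro nn_integral_mono ennreal_leI edist_nsphere_le_2) (simp_all add: space_sphere_volume)
  also have "\<dots> < \<infinity>" using V by (simp add: space_sphere_volume ennreal_mult_less_top)
  finally obtain a where a: "0 \<le> a" "A = ennreal a" by (cases A) auto
  have "(\<integral>x. edist (Suc n) x q \<partial>sphere_volume n) = enn2real A"
    unfolding A_def
    by (rule integral_eq_nn_integral) (auto intro!: measurable_sphere_volume simp: edist_nonneg)
  then have "mean_dist n q = a / V" using a V by (simp add: mean_dist_def measure_def)
  then show ?thesis
    using a V by (simp add: nn_integral_sphere_distribution A_def[symmetric] divide_ennreal)
qed

lemma mean_dist_nonneg: "0 \<le> mean_dist n q"
  unfolding mean_dist_def by (intro divide_nonneg_nonneg integral_nonneg_AE) (auto simp: edist_nonneg)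

lemma mean_dist_eq_pole:
  assumes "q \<in> topspace (nsphere n)"
  shows "mean_dist n q = mean_dist n (pole n)"
proof -
  have zonal: "(\<integral>\<^sup>+x. ennreal (edist (Suc n) x p) \<partial>sphere_volume n)
      = zonal_integral n (\<lambda>a. ennreal (sqrt (2 - 2 * a))) p"
    if "p \<in> topspace (nsphere n)" for p
    unfolding zonal_integral_def using that
    by (intro nn_integral_cong) (simp add: edist_nsphere space_sphere_volume)
  have "zonal_integral n (\<lambda>a. ennreal (sqrt (2 - 2 * a))) q
      = zonal_integral n (\<lambda>a. ennreal (sqrt (2 - 2 * a))) (pole n)"
    using assms by (intro zonal_integral_pole) measurable
  then have "ennreal (mean_dist n q) = ennreal (mean_dist n (pole n))"
    using assms pole_in_nsphere[of n]
    by (simp add: nn_integral_sphere_distribution zonal flip: nn_integral_edist_sphere_distribution)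
  then show ?thesis by (simp add: mean_dist_nonneg)
qed

lemma mean_dist_le_sqrt_2:
  assumes q: "q \<in> topspace (nsphere n)"
  shows "mean_dist n q \<le> sqrt 2"
proof -
  interpret prob_space "sphere_distribution n" by (rule prob_space_sphere_distribution)
  define q' where "q' = (\<lambda>i. - q i)"
  have q': "q' \<in> topspace (nsphere n)" unfolding q'_def using q by (rule uminus_in_nsphere)
  have meas: "(\<lambda>x. ennreal (edist (Suc n) x p)) \<in> borel_measurable (sphere_distribution n)" for p
    by (rule measurable_sphere_distribution) measurable
  have "ennreal (mean_dist n q + mean_dist n q')
    = (\<integral>\<^sup>+x. ennreal (edist (Suc n) x q) + ennreal (edist (Suc n) x q') \<partial>sphere_distribution n)"
    using q q' by (simp add: nn_integral_add meas nn_integral_edist_sphere_distribution mean_dist_nonneg)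
  also have "\<dots> \<le> (\<integral>\<^sup>+x. ennreal (2 * sqrt 2) \<partial>sphere_distribution n)"
  proof (rule nn_integral_mono)
    fix x assume "x \<in> space (sphere_distribution n)"
    then have "edist (Suc n) x q + edist (Suc n) x q' \<le> 2 * sqrt 2"
      unfolding q'_def using q by (intro edist_antipode_le) (simp_all add: space_sphere_distribution)
    then show "ennreal (edist (Suc n) x q) + ennreal (edist (Suc n) x q') \<le> ennreal (2 * sqrt 2)"
      by (simp add: edist_nonneg ennreal_leI flip: ennreal_plus)
  qed
  also have "\<dots> = ennreal (2 * sqrt 2)" by (simp add: emeasure_space_1)
  finally have "mean_dist n q + mean_dist n q' \<le> 2 * sqrt 2" by (subst (asm) ennreal_le_iff) auto
  then show ?thesis using mean_dist_eq_pole[OF q] mean_dist_eq_pole[OF q'] by simp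
qed

lemma (in complete_midpoint_space) ex_barycenter_nsphere:
  assumes f: "f \<in> topspace (nsphere n) \<rightarrow> Y" "elipschitz_on (Suc n) L (topspace (nsphere n)) f"
  obtains b where "b \<in> Y" "\<And>q. q \<in> topspace (nsphere n) \<Longrightarrow> dist b (f q) \<le> L * mean_dist n q"
proof -
  obtain \<beta> where \<beta>: "contracting_mean (sphere_distribution n) Y (sphere_Lipschitz n Y) \<beta>"
    using ex_contracting_mean_sphere by blast
  have L: "0 \<le> L" using f(2) by (simp add: elipschitz_on_def)
  have f_mem: "f \<in> sphere_Lipschitz n Y" using f by (auto simp: sphere_Lipschitz_def)
  show ?thesis
  proof (rule that)
    show "\<beta> f \<in> Y" using \<beta> f_mem by (rule contracting_mean_in)
    fix q assume q: "q \<in> topspace (nsphere n)"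
    then have fq: "f q \<in> Y" using f(1) by blast
    have meas: "(\<lambda>x. ennreal (edist (Suc n) x q)) \<in> borel_measurable (sphere_distribution n)"
      by (rule measurable_sphere_distribution) measurable
    have "ennreal (dist (\<beta> f) (\<beta> (\<lambda>_. f q)))
        \<le> (\<integral>\<^sup>+x. ennreal L * ennreal (edist (Suc n) x q) \<partial>sphere_distribution n)"
    proof (rule contracting_mean_dist_le[OF \<beta> f_mem])
      show "(\<lambda>_. f q) \<in> sphere_Lipschitz n Y"
        using fq by (auto simp: sphere_Lipschitz_def elipschitz_on_def intro!: exI[of _ 0])
      show "(\<lambda>x. ennreal L * ennreal (edist (Suc n) x q)) \<in> borel_measurable (sphere_distribution n)"
        using meas by measurable
      fix x assume "x \<in> space (sphere_distribution n)"
      then have "dist (f x) (f q) \<le> L * edist (Suc n) x q"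
        using f(2) q by (simp add: elipschitz_on_def space_sphere_distribution)
      then show "ennreal (dist (f x) (f q)) \<le> ennreal L * ennreal (edist (Suc n) x q)"
        using L by (simp add: edist_nonneg ennreal_leI flip: ennreal_mult)
    qed
    also have "\<dots> = ennreal (L * mean_dist n q)"
      using L q
      by (simp add: nn_integral_cmult meas nn_integral_edist_sphere_distribution ennreal_mult
        mean_dist_nonneg)
    finally show "dist (\<beta> f) (f q) \<le> L * mean_dist n q"
      using L fq by (simp add: contracting_mean_const[OF \<beta>] ennreal_le_iff mean_dist_nonneg)
  qed
qed

section \<open>Lipschitz extension to the ball\<close>

lemma continuous_map_sqnorm: "continuous_map (Euclidean_space k) euclideanreal (sqnorm k)"
proof -
  have "continuous_map (Euclidean_space k) euclideanreal (\<lambda>x. x i)" for i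
    unfolding Euclidean_space_def
    by (intro continuous_map_from_subtopology continuous_map_product_projection) simp
  then show ?thesis unfolding sqnorm_def[abs_def]
    by (intro continuous_map_sum continuous_map_real_pow) auto
qed

lemma unit_eball_eq: "unit_eball k = {x \<in> topspace (Euclidean_space k). sqnorm k x \<le> 1}"
  by (simp add: unit_eball_def edist_eq_sqnorm)

lemma topspace_nsphere_eq:
  "topspace (nsphere n) = {x \<in> topspace (Euclidean_space (Suc n)). sqnorm (Suc n) x = 1}"
  by (auto simp: in_nsphere_iff topspace_Euclidean_space Suc_le_eq)

lemma nsphere_not_in_interior_unit_eball:
  assumes x: "x \<in> topspace (nsphere n)"
  shows "x \<notin> Euclidean_space (Suc n) interior_of unit_eball (Suc n)"
proof
  let ?X = "Euclidean_space (Suc n)"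
  assume "x \<in> ?X interior_of unit_eball (Suc n)"
  then obtain T where T: "openin ?X T" "x \<in> T" "T \<subseteq> unit_eball (Suc n)" by (auto simp: interior_of_def)
  define ray where "ray t = (\<lambda>i. if i < Suc n then t * x i else 0)" for t :: real
  have "continuous_map euclideanreal ?X ray"
    unfolding ray_def continuous_map_componentwise_Euclidean_space by (auto intro!: continuous_intros)
  then have "openin euclideanreal {t \<in> topspace euclideanreal. ray t \<in> T}"
    using T(1) by (rule openin_continuous_map_preimage)
  then have "open {t. ray t \<in> T}" by simp
  moreover have "ray 1 = x" using x by (auto simp: ray_def in_nsphere_iff fun_eq_iff)
  ultimately obtain e where e: "e > 0" "\<And>t. dist t 1 < e \<Longrightarrow> ray t \<in> T"
    using T(2) unfolding open_dist by force
  have "sqnorm (Suc n) (ray t) = t\<^sup>2 * sqnorm (Suc n) x" for t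
    unfolding sqnorm_scale[symmetric] by (rule sqnorm_cong) (simp add: ray_def)
  moreover have "ray (1 + e / 2) \<in> unit_eball (Suc n)" using e T(3) by (auto simp: dist_real_def)
  ultimately have "(1 + e / 2)\<^sup>2 \<le> 1" using x by (simp add: unit_eball_eq in_nsphere_iff)
  moreover have "1\<^sup>2 < (1 + e / 2)\<^sup>2" using e(1) by (intro power_strict_mono) auto
  ultimately show False by simp
qed

lemma frontier_unit_eball:
  "Euclidean_space (Suc n) frontier_of unit_eball (Suc n) = topspace (nsphere n)"
proof -
  let ?X = "Euclidean_space (Suc n)"
  have "closedin ?X {x \<in> topspace ?X. sqnorm (Suc n) x \<in> {..1}}"
    by (rule closedin_continuous_map_preimage[OF continuous_map_sqnorm]) simp
  then have "closedin ?X (unit_eball (Suc n))" by (simp add: unit_eball_eq)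
  then have "?X frontier_of unit_eball (Suc n) = unit_eball (Suc n) - ?X interior_of unit_eball (Suc n)"
    by (simp add: frontier_of_def closure_of_closedin)
  moreover have "openin ?X {x \<in> topspace ?X. sqnorm (Suc n) x \<in> {..<1}}"
    by (rule openin_continuous_map_preimage[OF continuous_map_sqnorm]) simp
  then have "{x \<in> topspace ?X. sqnorm (Suc n) x < 1} \<subseteq> ?X interior_of unit_eball (Suc n)"
    by (intro interior_of_maximal) (auto simp: unit_eball_eq)
  ultimately show ?thesis
    using nsphere_not_in_interior_unit_eball[of _ n] unfolding topspace_nsphere_eq unit_eball_eq by force
qed

lemma LC_mono:
  assumes "LC k K c Y" "c \<le> c'"
  shows "LC k K c' Y"
  unfolding LC_def
proof (intro allI impI, elim conjE)
  fix L f
  assume f: "f \<in> Euclidean_space k frontier_of K \<rightarrow> Y"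
    and L: "elipschitz_on k L (Euclidean_space k frontier_of K) f"
  then obtain F where F: "F \<in> K \<rightarrow> Y" "elipschitz_on k (c * L) K F"
      "\<forall>x\<in>Euclidean_space k frontier_of K. F x = f x"
    using assms(1) unfolding LC_def by blast
  have cL: "c * L \<le> c' * L"
    using L assms(2) by (simp add: elipschitz_on_def mult_right_mono)
  have "elipschitz_on k (c' * L) K F"
    unfolding elipschitz_on_def
  proof (intro conjI ballI)
    show "0 \<le> c' * L" using F(2) cL by (simp add: elipschitz_on_def)
    fix x y assume "x \<in> K" "y \<in> K"
    then have "dist (F x) (F y) \<le> c * L * edist k x y" using F(2) by (simp add: elipschitz_on_def)
    also have "\<dots> \<le> c' * L * edist k x y" using cL edist_nonneg by (rule mult_right_mono)
    finally show "dist (F x) (F y) \<le> c' * L * edist k x y" .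
  qed
  then show "\<exists>F. F \<in> K \<rightarrow> Y \<and> elipschitz_on k (c' * L) K F
      \<and> (\<forall>x\<in>Euclidean_space k frontier_of K. F x = f x)"
    using F by blast
qed

lemma Cauchy_Schwarz_2: "a + b * c \<le> sqrt (1 + c\<^sup>2) * sqrt (a\<^sup>2 + b\<^sup>2)" for a b c :: real
proof -
  have "(a + b * c)\<^sup>2 \<le> (1 + c\<^sup>2) * (a\<^sup>2 + b\<^sup>2)"
    using zero_le_power2[of "a * c - b"] by (simp add: power2_eq_square algebra_simps)
  then show ?thesis by (simp add: real_le_rsqrt flip: real_sqrt_mult)
qed

context complete_midpoint_space
begin

definition cone_map :: "nat \<Rightarrow> 'a \<Rightarrow> ((nat \<Rightarrow> real) \<Rightarrow> 'a) \<Rightarrow> (nat \<Rightarrow> real) \<Rightarrow> 'a" where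
  "cone_map n b f x = geodesic (sqrt (sqnorm (Suc n) x)) b (f (direction n x))"

lemma dist_cone_map_le:
  assumes f: "f \<in> topspace (nsphere n) \<rightarrow> Y" "elipschitz_on (Suc n) L (topspace (nsphere n)) f"
    and b: "b \<in> Y" "\<And>q. q \<in> topspace (nsphere n) \<Longrightarrow> dist b (f q) \<le> L * c"
    and xy: "sqnorm (Suc n) x \<le> sqnorm (Suc n) y"
  shows "dist (cone_map n b f x) (cone_map n b f y) \<le> sqrt (1 + c\<^sup>2) * L * edist (Suc n) x y"
proof -
  define r s where "r = sqrt (sqnorm (Suc n) x)" and "s = sqrt (sqnorm (Suc n) y)"
  define p q where "p = direction n x" and "q = direction n y"
  define d where "d = edist (Suc n) p q"
  have rs: "0 \<le> r" "r \<le> s" using xy by (auto simp: r_def s_def sqnorm_nonneg)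
  have pq: "p \<in> topspace (nsphere n)" "q \<in> topspace (nsphere n)"
    by (simp_all add: p_def q_def direction_in_nsphere)
  then have fpq: "f p \<in> Y" "f q \<in> Y" using f(1) by auto
  have L: "0 \<le> L" using f(2) by (rule elipschitz_on_nonneg)
  have "dist (cone_map n b f x) (cone_map n b f y)
    \<le> dist (geodesic r b (f p)) (geodesic r b (f q)) + dist (geodesic r b (f q)) (geodesic s b (f q))"
    unfolding cone_map_def r_def s_def p_def q_def by (rule dist_triangle)
  also have "\<dots> \<le> r * dist (f p) (f q) + \<bar>r - s\<bar> * dist b (f q)"
    using rs b fpq by (intro add_mono geodesic_contract dist_geodesic_le) auto
  also have "\<dots> \<le> r * (L * d) + \<bar>r - s\<bar> * (L * c)"
    unfolding d_def using rs b(2)[OF pq(2)] elipschitz_onD[OF f(2) pq]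
    by (intro add_mono mult_left_mono) auto
  also have "\<dots> = L * (r * d + (s - r) * c)" using rs by (simp add: algebra_simps)
  also have "\<dots> \<le> L * (sqrt (1 + c\<^sup>2) * sqrt ((r * d)\<^sup>2 + (s - r)\<^sup>2))"
    using L by (intro mult_left_mono Cauchy_Schwarz_2)
  also have "\<dots> \<le> L * (sqrt (1 + c\<^sup>2) * edist (Suc n) x y)"
    unfolding r_def s_def d_def p_def q_def
    using L xy by (intro mult_left_mono edist_ge_direction) auto
  finally show ?thesis by (simp add: mult_ac)
qed

lemma elipschitz_on_cone_map:
  assumes "f \<in> topspace (nsphere n) \<rightarrow> Y" "elipschitz_on (Suc n) L (topspace (nsphere n)) f"
    and "b \<in> Y" "\<And>q. q \<in> topspace (nsphere n) \<Longrightarrow> dist b (f q) \<le> L * c"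
  shows "elipschitz_on (Suc n) (sqrt (1 + c\<^sup>2) * L) A (cone_map n b f)"
  unfolding elipschitz_on_def
proof (intro conjI ballI)
  show "0 \<le> sqrt (1 + c\<^sup>2) * L" using assms(2) by (simp add: elipschitz_on_def)
  show "dist (cone_map n b f x) (cone_map n b f y) \<le> sqrt (1 + c\<^sup>2) * L * edist (Suc n) x y" for x y
    using dist_cone_map_le[OF assms, of x y] dist_cone_map_le[OF assms, of y x]
    by (cases "sqnorm (Suc n) x \<le> sqnorm (Suc n) y") (simp_all add: dist_commute edist_commute)
qed

theorem LC_unit_eball:
  assumes q: "q \<in> topspace (nsphere n)"
  shows "LC (Suc n) (unit_eball (Suc n)) (sqrt (1 + (mean_dist n q)\<^sup>2)) Y"
  unfolding LC_def frontier_unit_eball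
proof (intro allI impI, elim conjE)
  fix L f
  let ?S = "topspace (nsphere n)"
  assume f: "f \<in> ?S \<rightarrow> Y" "elipschitz_on (Suc n) L ?S f"
  obtain b where b: "b \<in> Y" "\<And>p. p \<in> ?S \<Longrightarrow> dist b (f p) \<le> L * mean_dist n p"
    using ex_barycenter_nsphere[OF f] by blast
  have "dist b (f p) \<le> L * mean_dist n q" if "p \<in> ?S" for p
    using b(2)[OF that] mean_dist_eq_pole[OF that] mean_dist_eq_pole[OF q] by simp
  then have "elipschitz_on (Suc n) (sqrt (1 + (mean_dist n q)\<^sup>2) * L) (unit_eball (Suc n))
      (cone_map n b f)"
    using f b(1) by (intro elipschitz_on_cone_map)
  moreover have "f (direction n x) \<in> Y" for x using f(1) direction_in_nsphere by blast
  then have "cone_map n b f \<in> unit_eball (Suc n) \<rightarrow> Y"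
    unfolding cone_map_def by (intro funcsetI geodesic_in b(1))
  moreover have "cone_map n b f x = f x" if "x \<in> ?S" for x
  proof -
    have "sqnorm (Suc n) x = 1" "f x \<in> Y" using that f(1) by (auto simp: in_nsphere_iff)
    then show ?thesis using that b(1) by (simp add: cone_map_def direction_nsphere geodesic_1)
  qed
  ultimately show "\<exists>F. F \<in> unit_eball (Suc n) \<rightarrow> Y \<and>
      elipschitz_on (Suc n) (sqrt (1 + (mean_dist n q)\<^sup>2) * L) (unit_eball (Suc n)) F \<and>
        (\<forall>x\<in>?S. F x = f x)"
    by blast
qed

end

theorem proposition7p3:
  fixes Y :: "'a::metric_space set"
  assumes "complete Y" and "generalized_nonpos_curved Y"
  shows "(\<forall>n. \<forall>q \<in> topspace (nsphere n).
            LC (Suc n) (unit_eball (Suc n)) (sqrt (1 + (mean_dist n q)\<^sup>2)) Y)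
         \<and> (\<forall>n. Lipschitz_connected n (sqrt 3) Y)"
proof -
  obtain mid where "midpoint_space Y mid"
    using assms(2) unfolding generalized_nonpos_curved_def midpoint_space_def by blast
  then interpret complete_midpoint_space Y mid
    using assms(1) by (simp add: complete_midpoint_space_def complete_midpoint_space_axioms_def)
  have "LC (Suc m) (unit_eball (Suc m)) (sqrt 3) Y" for m
  proof (rule LC_mono)
    show "LC (Suc m) (unit_eball (Suc m)) (sqrt (1 + (mean_dist m (pole m))\<^sup>2)) Y"
      using pole_in_nsphere by (rule LC_unit_eball)
    have "(mean_dist m (pole m))\<^sup>2 \<le> (sqrt 2)\<^sup>2"
      using mean_dist_le_sqrt_2[OF pole_in_nsphere] mean_dist_nonneg by (rule power_mono)
    then show "sqrt (1 + (mean_dist m (pole m))\<^sup>2) \<le> sqrt 3" by simp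
  qed
  then show ?thesis using LC_unit_eball by (simp add: Lipschitz_connected_def)
qed

end
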